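(* Let $\mu$ be a probability measure on $[1,\infty)$ and let $g(s)=\int e^{-sx}\mu(dx)$, $s>0$, be its Laplace transform. (i) If $$\lim_{s\downarrow0}-\frac{s\,g'(s)}{1-g(s)}=c_0 ,\qquad(\ast)$$ then necessarily $0\le c_0\le1$. (ii) The limit $(\ast)$ exists if: (a) $\mu$ has finite mean, and then $c_0=1$; or (b) for some $\alpha\in(0,1)$ $\mu$ belongs to the domain of attraction of an $\alpha$-stable law or, more generally, $\mu((x,\infty))=x^{-\alpha}L(x)$ where $L$ is a slowly varying function at $+\infty$ and $\alpha\in[0,1]$; in this case $c_0=\alpha$.
   Context: A function $L$ is slowly varying at infinity if $\lim_{x\to\infty}L(cx)/L(x)=1$ for every $c>0$. *)

theory Defs
  imports "HOL-Probability.Probability"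
begin

definition laplace_transform :: "real measure \<Rightarrow> real \<Rightarrow> real" where
  "laplace_transform \<mu> s = (LINT x|\<mu>. exp (- s * x))"

definition slowly_varying :: "(real \<Rightarrow> real) \<Rightarrow> bool" where
  "slowly_varying L \<longleftrightarrow> (\<forall>c>0. ((\<lambda>x. L (c * x) / L x) \<longlongrightarrow> 1) at_top)"

text \<open>The law of \<open>X\<^sub>1 + \<dots> + X\<^sub>n\<close> for independent \<open>X\<^sub>i\<close> with common law \<open>\<mu>\<close>.\<close>

definition iid_sum_law :: "real measure \<Rightarrow> nat \<Rightarrow> real measure" where
  "iid_sum_law \<mu> n = distr (Pi\<^sub>M {..<n} (\<lambda>_. \<mu>)) borel (\<lambda>\<omega>. \<Sum>i<n. \<omega> i)"

text \<open>Stability in the wide sense (arbitrary centering \<open>\<gamma>\<close>). Point masses satisfy the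
  convolution identity for every \<open>\<alpha>\<close> and are excluded, as usual.\<close>

definition stable_law :: "real \<Rightarrow> real measure \<Rightarrow> bool" where
  "stable_law \<alpha> D \<longleftrightarrow>
     0 < \<alpha> \<and> real_distribution D \<and> (\<forall>c. measure D {c} \<noteq> 1) \<and>
     (\<forall>n\<ge>1. \<exists>\<gamma>. iid_sum_law D n = distr D borel (\<lambda>x. real n powr (1 / \<alpha>) * x + \<gamma>))"

definition in_domain_of_attraction :: "real measure \<Rightarrow> real measure \<Rightarrow> bool" where
  "in_domain_of_attraction \<mu> D \<longleftrightarrow>
     (\<exists>a b. (\<forall>n. 0 < a n) \<and>
        weak_conv_m (\<lambda>n. distr (iid_sum_law \<mu> n) borel (\<lambda>x. (x - b n) / a n)) D)"

end

theory Submission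
  imports Defs
begin

text \<open>
  Write \<open>h = 1 - g\<close>, so that the quotient in question is \<open>s h'(s) / h(s)\<close>. Since \<open>h\<close> is concave with
  \<open>h(0) = 0\<close>, the quotient lies in \<open>[0, 1]\<close>, and comparing \<open>h'(s)\<close> with the secants between \<open>s\<close> and
  \<open>c s\<close> shows that it tends to \<open>\<alpha>\<close> as soon as \<open>h\<close> is regularly varying of index \<open>\<alpha>\<close> at \<open>0\<close>.

  Regular variation passes from \<open>f\<close> to a mixture \<open>h(s) = \<integral> f(s / u) p(u) du\<close> with bounded density \<open>p\<close>
  whenever \<open>h(s) / s \<rightarrow> \<infinity>\<close>, because the range where \<open>s / u\<close> is not small contributes only \<open>O(s)\<close>.
  With exponential \<open>p\<close> and \<open>f\<close> the tail function this settles regularly varying tails of infinite mean.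

  For the domain of attraction of a stable law let \<open>Y = X - X'\<close> be the symmetrized variable and
  \<open>k = 1 - \<bar>\<phi>\<bar>\<^sup>2\<close> with \<open>\<phi>\<close> the characteristic function of \<open>X\<close>. Convergence of the moduli of the
  characteristic functions gives \<open>n k(t / a\<^sub>n) \<rightarrow> - ln (\<bar>\<psi>(t)\<bar>\<^sup>2)\<close>, where \<open>\<psi>\<close> belongs to the stable law;
  integrating against the normal density makes \<open>G(s) = E(1 - exp (- s\<^sup>2 Y\<^sup>2 / 2))\<close> regularly varying, as
  \<open>G\<close> is monotone. The identity \<open>E exp (- a\<^sup>2 / (2 W\<^sup>2)) = exp (- a)\<close> for standard normal \<open>W\<close> turns
  \<open>E(1 - exp (- s \<bar>Y\<bar>))\<close> into a mixture of \<open>G\<close>, and this function is asymptotic to \<open>2 h(s)\<close>.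
\<close>

subsection \<open>Regular variation at zero\<close>

definition regvar_0 :: "real \<Rightarrow> (real \<Rightarrow> real) \<Rightarrow> bool" where
  "regvar_0 \<alpha> f \<longleftrightarrow> (\<forall>c>0. ((\<lambda>s. f (c * s) / f s) \<longlongrightarrow> c powr \<alpha>) (at_right 0))"

lemma regvar_0D: "regvar_0 \<alpha> f \<Longrightarrow> 0 < c \<Longrightarrow> ((\<lambda>s. f (c * s) / f s) \<longlongrightarrow> c powr \<alpha>) (at_right 0)"
  by (simp add: regvar_0_def)

text \<open>As \<open>x / 0 = 0\<close>, the quotient at \<open>c = 1\<close> can only tend to 1 if
  \<open>f s\<close> does not vanish near 0.\<close>

lemma regvar_0_eventually_nonzero:
  assumes "regvar_0 \<alpha> f"
  shows "eventually (\<lambda>s. f s \<noteq> 0) (at_right 0)"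
proof -
  have "((\<lambda>s. f (1 * s) / f s) \<longlongrightarrow> 1 powr \<alpha>) (at_right 0)"
    using assms by (rule regvar_0D) simp
  then have "eventually (\<lambda>s. f (1 * s) / f s > 0) (at_right 0)"
    by (rule order_tendstoD) simp
  then show ?thesis by eventually_elim auto
qed

lemma filterlim_mult_at_right_0:
  fixes c :: real
  assumes "0 < c"
  shows "filterlim (\<lambda>s. c * s) (at_right 0) (at_right 0)"
proof -
  have "((\<lambda>s. c * s) \<longlongrightarrow> c * 0) (at_right 0)"
    by (intro tendsto_intros)
  then show ?thesis
    using assms by (auto simp: filterlim_at eventually_at_filter)
qed

text \<open>\<open>g (c * s) / g s\<close> factors into the same quotient for \<open>f\<close> and
  two quotients of \<open>g\<close> by \<open>f\<close>, whose limits \<open>l\<close>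
  cancel.\<close>

lemma regvar_0_cong_ratio:
  assumes f: "regvar_0 \<alpha> f" and lim: "((\<lambda>s. g s / f s) \<longlongrightarrow> l) (at_right 0)" and "l \<noteq> 0"
  shows "regvar_0 \<alpha> g"
  unfolding regvar_0_def
proof (intro allI impI)
  fix c :: real assume c: "0 < c"
  have nz: "eventually (\<lambda>s. f s \<noteq> 0) (at_right 0)"
    using f by (rule regvar_0_eventually_nonzero)
  have nzc: "eventually (\<lambda>s. f (c * s) \<noteq> 0) (at_right 0)"
    using nz filterlim_mult_at_right_0[OF c] by (rule eventually_compose_filterlim)
  have limc: "((\<lambda>s. g (c * s) / f (c * s)) \<longlongrightarrow> l) (at_right 0)"
    using lim filterlim_mult_at_right_0[OF c] by (rule filterlim_compose)
  have "((\<lambda>s. (g (c * s) / f (c * s)) * (f (c * s) / f s) / (g s / f s)) \<longlongrightarrow> l * c powr \<alpha> / l) (at_right 0)"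
    by (intro tendsto_intros limc lim regvar_0D[OF f c] \<open>l \<noteq> 0\<close>)
  then have "((\<lambda>s. (g (c * s) / f (c * s)) * (f (c * s) / f s) / (g s / f s)) \<longlongrightarrow> c powr \<alpha>) (at_right 0)"
    using \<open>l \<noteq> 0\<close> by simp
  then show "((\<lambda>s. g (c * s) / g s) \<longlongrightarrow> c powr \<alpha>) (at_right 0)"
    by (rule Lim_transform_eventually) (use nz nzc in eventually_elim, auto)
qed

text \<open>For \<open>\<alpha> < 1\<close>, halving a small argument multiplies \<open>f\<close> by
  at least a fixed factor above 1/2, so \<open>f s / s\<close> grows geometrically along
  \<open>y / 2 ^ n\<close>. This later excludes a finite mean.\<close>

lemma regvar_0_unbounded_quotient:
  assumes rv: "regvar_0 \<alpha> f" and "\<alpha> < 1" and nonneg: "\<And>s. 0 < s \<Longrightarrow> 0 \<le> f s"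
  shows "\<not> (\<forall>s>0. f s \<le> K * s)"
proof
  assume bd: "\<forall>s>0. f s \<le> K * s"
  \<comment> \<open>The midpoint of 1/2 and \<open>(1/2) powr \<alpha>\<close>: below the limiting
    ratio of \<open>f\<close>, yet above the ratio 1/2 of a linear function.\<close>
  define \<rho> where "\<rho> = (1/2 + (1/2) powr \<alpha>) / 2"
  have half: "(1/2) powr \<alpha> > (1/2 :: real)"
    using powr_less_mono'[of "1/2" \<alpha> 1] \<open>\<alpha> < 1\<close> by simp
  have \<rho>: "\<rho> > 1/2" "\<rho> < (1/2) powr \<alpha>" using half by (auto simp: \<rho>_def)
  have "eventually (\<lambda>s. f (1/2 * s) / f s > \<rho>) (at_right 0)"
    using regvar_0D[OF rv, of "1/2"] \<rho>(2) by (intro order_tendstoD) auto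
  moreover have "eventually (\<lambda>s. f s \<noteq> 0) (at_right 0)"
    using rv by (rule regvar_0_eventually_nonzero)
  ultimately have "eventually (\<lambda>s. f (1/2 * s) / f s > \<rho> \<and> f s \<noteq> 0) (at_right 0)"
    by eventually_elim auto
  then obtain d where d: "0 < d" "\<And>s. 0 < s \<Longrightarrow> s < d \<Longrightarrow> f (1/2 * s) / f s > \<rho> \<and> f s \<noteq> 0"
    by (auto simp: eventually_at_right_field)
  define y where "y = d / 2"
  have y: "0 < y" "y < d" using d by (auto simp: y_def)
  have step: "f (s / 2) \<ge> \<rho> * f s" if "0 < s" "s < d" for s
  proof -
    have "f s > 0" using d(2)[OF that] nonneg[OF that(1)] by linarith
    then show ?thesis using d(2)[OF that] by (simp add: field_simps)
  qed
  have iter: "f (y / 2 ^ n) \<ge> \<rho> ^ n * f y" for n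
  proof (induction n)
    case (Suc n)
    have le: "y / 2 ^ n \<le> y" using y by (simp add: field_simps)
    have "\<rho> ^ Suc n * f y \<le> \<rho> * f (y / 2 ^ n)" using Suc \<rho> by simp
    also have "\<dots> \<le> f (y / 2 ^ n / 2)" using y le by (intro step) auto
    finally show ?case by (simp add: field_simps)
  qed simp
  have bound: "(2 * \<rho>) ^ n \<le> K * y / f y" for n
  proof -
    have "f y > 0" using d(2)[OF y] nonneg[OF y(1)] by linarith
    moreover have "\<rho> ^ n * f y \<le> K * (y / 2 ^ n)"
      using iter[of n] bd y by (meson divide_pos_pos order_trans zero_less_numeral zero_less_power)
    ultimately show ?thesis by (simp add: field_simps power_mult_distrib)
  qed
  obtain n where "K * y / f y < (2 * \<rho>) ^ n"
    using real_arch_pow[of "2 * \<rho>" "K * y / f y"] \<rho> by auto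
  with bound[of n] show False by simp
qed

text \<open>The tangent inequality at \<open>s\<close>, evaluated at \<open>c * s\<close>, gives
  \<open>h (c * s) / h s - 1 \<le> (c - 1) * (s * D s / h s)\<close>. Dividing by
  \<open>c - 1\<close> yields a lower bound for \<open>c > 1\<close> and an upper bound for
  \<open>c < 1\<close>. As \<open>s\<close> tends to 0 both become
  \<open>(c powr \<alpha> - 1) / (c - 1)\<close>, which is close to \<open>\<alpha>\<close> for
  \<open>c\<close> near 1.\<close>

lemma regvar_0_imp_log_derivative_limit:
  assumes rv: "regvar_0 \<alpha> h"
    and pos: "\<And>s. 0 < s \<Longrightarrow> 0 < h s"
    and tangent: "\<And>x y. 0 < x \<Longrightarrow> 0 < y \<Longrightarrow> h y \<le> h x + D x * (y - x)"
  shows "((\<lambda>s. s * D s / h s) \<longlongrightarrow> \<alpha>) (at_right 0)"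
proof -
  have slope: "((\<lambda>c. (c powr \<alpha> - 1) / (c - 1)) \<longlongrightarrow> \<alpha>) (at 1)"
  proof -
    have "((\<lambda>c. c powr \<alpha>) has_real_derivative \<alpha> * 1 powr (\<alpha> - 1)) (at 1)"
      by (rule has_real_derivative_powr) simp
    then show ?thesis by (simp add: has_field_derivative_iff)
  qed
  have sec: "(h (c * s) - h s) / h s \<le> (c - 1) * (s * D s / h s)" if "0 < s" "0 < c" for c s
  proof -
    have "h (c * s) - h s \<le> D s * (c * s - s)" using tangent[of s "c * s"] that by simp
    also have "\<dots> = (c - 1) * (s * D s)" by (simp add: algebra_simps)
    finally show ?thesis using pos[OF that(1)] by (simp add: divide_right_mono)
  qed
  have lim: "((\<lambda>s. (h (c * s) - h s) / h s) \<longlongrightarrow> c powr \<alpha> - 1) (at_right 0)" if "0 < c" for c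
  proof (rule Lim_transform_eventually)
    show "((\<lambda>s. h (c * s) / h s - 1) \<longlongrightarrow> c powr \<alpha> - 1) (at_right 0)"
      by (intro tendsto_intros regvar_0D[OF rv that])
    show "\<forall>\<^sub>F s in at_right 0. h (c * s) / h s - 1 = (h (c * s) - h s) / h s"
      using eventually_at_right_less[of 0]
      by eventually_elim (use pos in \<open>force simp: field_simps\<close>)
  qed
  show ?thesis
  proof (rule order_tendstoI)
    fix a assume "a < \<alpha>"
    moreover have "((\<lambda>c. (c powr \<alpha> - 1) / (c - 1)) \<longlongrightarrow> \<alpha>) (at_right 1)"
      using slope by (rule filterlim_mono) (auto simp: at_le)
    ultimately have "eventually (\<lambda>c. a < (c powr \<alpha> - 1) / (c - 1)) (at_right 1)"
      by (intro order_tendstoD)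
    then obtain c where c: "c > 1" "a < (c powr \<alpha> - 1) / (c - 1)"
      using eventually_happens[OF eventually_conj[OF _ eventually_at_right_less[of "1::real"]]]
      by fastforce
    then have "a * (c - 1) < c powr \<alpha> - 1" by (simp add: field_simps)
    then have "eventually (\<lambda>s. a * (c - 1) < (h (c * s) - h s) / h s) (at_right 0)"
      using lim[of c] c by (intro order_tendstoD) auto
    with eventually_at_right_less[of 0]
    show "eventually (\<lambda>s. a < s * D s / h s) (at_right 0)"
    proof eventually_elim
      case (elim s)
      have "a * (c - 1) < (c - 1) * (s * D s / h s)"
        using elim sec[of s c] c by linarith
      then show ?case using c by (simp only: mult.commute[of a] mult_less_cancel_left_pos)
    qed
  next
    fix a assume "\<alpha> < a"
    moreover have "((\<lambda>c. (c powr \<alpha> - 1) / (c - 1)) \<longlongrightarrow> \<alpha>) (at_left 1)"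
      using slope by (rule filterlim_mono) (auto simp: at_le)
    ultimately have "eventually (\<lambda>c. (c powr \<alpha> - 1) / (c - 1) < a) (at_left 1)"
      by (intro order_tendstoD)
    moreover have "eventually (\<lambda>c. c \<in> {0<..<1}) (at_left (1::real))"
      by (rule eventually_at_left_real) simp
    ultimately have "eventually (\<lambda>c. (c powr \<alpha> - 1) / (c - 1) < a \<and> c \<in> {0<..<1}) (at_left 1)"
      by (rule eventually_conj)
    from eventually_happens'[OF trivial_limit_at_left_real this]
    obtain c where c: "0 < c" "c < 1" "(c powr \<alpha> - 1) / (c - 1) < a"
      by auto
    then have "a * (c - 1) < c powr \<alpha> - 1" by (simp add: divide_less_eq)
    then have "eventually (\<lambda>s. a * (c - 1) < (h (c * s) - h s) / h s) (at_right 0)"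
      using lim[of c] c by (intro order_tendstoD) auto
    with eventually_at_right_less[of 0]
    show "eventually (\<lambda>s. s * D s / h s < a) (at_right 0)"
    proof eventually_elim
      case (elim s)
      have "a * (c - 1) < (c - 1) * (s * D s / h s)"
        using elim sec[of s c] c by linarith
      then show ?case using c by (simp only: mult.commute[of a] mult_less_cancel_left_neg)
    qed
  qed
qed

text \<open>Each small \<open>s\<close> lies between \<open>1 / a (Suc n)\<close> and
  \<open>1 / a n\<close> for some large \<open>n\<close>, so monotonicity traps
  \<open>G (c * s) / G s\<close> between quotients of \<open>G\<close> along the sequence, whose
  limits are known.\<close>

lemma regvar_0_from_sequence:
  assumes mono: "\<And>s t. 0 < s \<Longrightarrow> s \<le> t \<Longrightarrow> G s \<le> G t"
    and apos: "\<And>n. 0 < a n" and a: "filterlim a at_top sequentially"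
    and lim: "\<And>s. 0 < s \<Longrightarrow> (\<lambda>n. real n * G (s / a n)) \<longlonglongrightarrow> C * s powr \<alpha>"
    and C: "0 < C"
  shows "regvar_0 \<alpha> G"
  unfolding regvar_0_def
proof (intro allI impI)
  fix c :: real assume c: "0 < c"
  \<comment> \<open>\<open>N s\<close> is the last index with \<open>a n * s \<le> 1\<close>, so
    \<open>Suc (N s)\<close> violates this. Divergence of \<open>a\<close> makes \<open>S s\<close>
    finite; every fixed index lies in \<open>S s\<close> for small \<open>s\<close>, so
    \<open>N s\<close> tends to infinity.\<close>
  define S where "S s = {n. a n * s \<le> 1}" for s
  define N where "N s = Max (S s)" for s
  have fin: "finite (S s)" if "0 < s" for s
  proof -
    have "eventually (\<lambda>n. a n > 1 / s) sequentially"
      using a by (simp add: filterlim_at_top_dense)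
    then obtain n0 where n0: "\<And>n. n \<ge> n0 \<Longrightarrow> a n > 1 / s" by (auto simp: eventually_sequentially)
    have "n < n0" if "n \<in> S s" for n
    proof (rule ccontr)
      assume "\<not> n < n0"
      then have "a n > 1 / s" using n0 by simp
      then show False using that \<open>0 < s\<close> by (simp add: S_def field_simps)
    qed
    then have "S s \<subseteq> {..<n0}" by auto
    then show ?thesis by (rule finite_subset) simp
  qed
  have small: "eventually (\<lambda>s. 0 < s \<and> s \<le> 1 / a n0) (at_right 0)" for n0
    unfolding eventually_at_right_field using apos[of n0]
    by (intro exI[of _ "1 / a n0"]) auto
  have inS: "n0 \<in> S s" if "0 < s \<and> s \<le> 1 / a n0" for s n0
    using that apos[of n0] by (simp add: S_def field_simps)
  have Nlim: "filterlim N sequentially (at_right 0)"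
    unfolding filterlim_at_top
  proof
    fix n0
    show "eventually (\<lambda>s. n0 \<le> N s) (at_right 0)"
      using small[of n0] by eventually_elim (use fin inS in \<open>auto simp: N_def intro!: Max_ge\<close>)
  qed
  have Nprop: "eventually (\<lambda>s. 0 < s \<and> s \<le> 1 / a (N s) \<and> 1 / a (Suc (N s)) < s) (at_right 0)"
    using small[of 0]
  proof eventually_elim
    case (elim s)
    have "N s \<in> S s" unfolding N_def by (rule Max_in) (use fin elim inS in auto)
    moreover have "Suc (N s) \<notin> S s"
    proof
      assume "Suc (N s) \<in> S s"
      then have "Suc (N s) \<le> N s" unfolding N_def[of s] by (intro Max_ge fin) (use elim in auto)
      then show False by simp
    qed
    ultimately show ?case using elim apos[of "N s"] apos[of "Suc (N s)"]
      by (simp add: S_def field_simps)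
  qed
  define U where "U = (\<lambda>s n. real n * G (s / a n))"
  have Ulim: "U s \<longlonglongrightarrow> C * s powr \<alpha>" if "0 < s" for s
    using lim[OF that] unfolding U_def .
  have USuc: "(\<lambda>n. U s (Suc n)) \<longlonglongrightarrow> C * s powr \<alpha>" if "0 < s" for s
    using Ulim[OF that] by (rule LIMSEQ_Suc)
  \<comment> \<open>The bounds compare \<open>G\<close> at consecutive indices; these factors, which
    tend to 1, exchange the weights \<open>n\<close> and \<open>Suc n\<close>.\<close>
  have r1: "(\<lambda>n. real (Suc n) / real n) \<longlonglongrightarrow> 1" by (rule LIMSEQ_Suc_n_over_n)
  have r2: "(\<lambda>n. real n / real (Suc n)) \<longlonglongrightarrow> 1" by (rule LIMSEQ_n_over_Suc_n)
  have "(\<lambda>n. U c n / U 1 (Suc n) * (real (Suc n) / real n)) \<longlonglongrightarrow> C * c powr \<alpha> / (C * 1 powr \<alpha>) * 1"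
    using C by (intro tendsto_intros r1 Ulim USuc c) auto
  then have up: "(\<lambda>n. U c n / U 1 (Suc n) * (real (Suc n) / real n)) \<longlonglongrightarrow> c powr \<alpha>" using C by simp
  have "(\<lambda>n. U c (Suc n) / U 1 n * (real n / real (Suc n))) \<longlonglongrightarrow> C * c powr \<alpha> / (C * 1 powr \<alpha>) * 1"
    using C by (intro tendsto_intros r2 Ulim USuc c) auto
  then have lo: "(\<lambda>n. U c (Suc n) / U 1 n * (real n / real (Suc n))) \<longlonglongrightarrow> c powr \<alpha>" using C by simp
  have posU: "eventually (\<lambda>n. 0 < U s n) sequentially" if "0 < s" for s
    using order_tendstoD(1)[OF Ulim[OF that], of 0] C that by simp
  have ev: "eventually (\<lambda>n. 0 < n \<and> 0 < U 1 n \<and> 0 < U c n \<and> 0 < U 1 (Suc n) \<and> 0 < U c (Suc n)) sequentially"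
    using posU[OF zero_less_one] posU[OF c] eventually_gt_at_top[of 0]
      eventually_compose_filterlim[OF posU[OF zero_less_one] filterlim_Suc]
      eventually_compose_filterlim[OF posU[OF c] filterlim_Suc]
    by (simp add: eventually_conj_iff)
  have evs: "eventually (\<lambda>s. 0 < N s \<and> 0 < U 1 (N s) \<and> 0 < U c (N s) \<and> 0 < U 1 (Suc (N s)) \<and> 0 < U c (Suc (N s))) (at_right 0)"
    using ev Nlim by (rule eventually_compose_filterlim)
  show "((\<lambda>s. G (c * s) / G s) \<longlongrightarrow> c powr \<alpha>) (at_right 0)"
  proof (rule tendsto_sandwich)
    show "((\<lambda>s. U c (Suc (N s)) / U 1 (N s) * (real (N s) / real (Suc (N s)))) \<longlongrightarrow> c powr \<alpha>) (at_right 0)"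
      using lo Nlim by (rule filterlim_compose)
    show "((\<lambda>s. U c (N s) / U 1 (Suc (N s)) * (real (Suc (N s)) / real (N s))) \<longlongrightarrow> c powr \<alpha>) (at_right 0)"
      using up Nlim by (rule filterlim_compose)
    show "eventually (\<lambda>s. U c (Suc (N s)) / U 1 (N s) * (real (N s) / real (Suc (N s))) \<le> G (c * s) / G s) (at_right 0)"
      using Nprop evs
    proof eventually_elim
      case (elim s)
      define n where "n = N s"
      have p: "0 < n" "0 < G (1 / a n)" "0 < G (c / a (Suc n))" "0 < G (1 / a (Suc n))"
        using elim unfolding U_def n_def[symmetric] by (auto simp: zero_less_mult_iff)
      have m: "G (1 / a (Suc n)) \<le> G s" "G s \<le> G (1 / a n)" "G (c / a (Suc n)) \<le> G (c * s)"
        using elim apos[of "Suc n"] c unfolding n_def[symmetric]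
        by (auto intro!: mono simp: field_simps)
      have "U c (Suc n) / U 1 n * (real n / real (Suc n)) = G (c / a (Suc n)) / G (1 / a n)"
        using p by (simp add: U_def field_simps del: of_nat_Suc)
      also have "\<dots> \<le> G (c * s) / G s"
        using m p by (intro frac_le) auto
      finally show ?case by (simp add: n_def)
    qed
    show "eventually (\<lambda>s. G (c * s) / G s \<le> U c (N s) / U 1 (Suc (N s)) * (real (Suc (N s)) / real (N s))) (at_right 0)"
      using Nprop evs
    proof eventually_elim
      case (elim s)
      define n where "n = N s"
      have p: "0 < n" "0 < G (1 / a (Suc n))" "0 < G (c / a n)"
        using elim unfolding U_def n_def[symmetric] by (auto simp: zero_less_mult_iff)
      have m: "G (1 / a (Suc n)) \<le> G s" "G (c * s) \<le> G (c / a n)"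
        using elim apos[of "Suc n"] apos[of n] c unfolding n_def[symmetric]
        by (auto intro!: mono simp: field_simps)
      have "G (c * s) / G s \<le> G (c / a n) / G (1 / a (Suc n))"
        using m p by (intro frac_le) auto
      also have "\<dots> = U c n / U 1 (Suc n) * (real (Suc n) / real n)"
        using p by (simp add: U_def field_simps del: of_nat_Suc)
      finally show ?case by (simp add: n_def)
    qed
  qed
qed

text \<open>Where \<open>s / u < d\<close>, the value \<open>f (c * s / u)\<close> is
  \<open>c powr \<alpha> * f (s / u)\<close> up to a small relative error. The remaining
  \<open>u\<close> fill an interval of length \<open>s / d\<close> on which the integrand is
  bounded; this error \<open>O(s)\<close> is negligible against \<open>h s\<close> by
  \<open>hlim\<close>.\<close>

lemma regvar_0_mixture:
  fixes f p :: "real \<Rightarrow> real"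
  assumes rv: "regvar_0 \<alpha> f"
    and f[measurable]: "f \<in> borel_measurable borel" and f01: "\<And>s. 0 \<le> f s" "\<And>s. f s \<le> 1"
    and p: "integrable lborel p" "\<And>u. 0 \<le> p u" "\<And>u. p u \<le> B" "\<And>u. u \<le> 0 \<Longrightarrow> p u = 0"
    and h: "\<And>s. 0 < s \<Longrightarrow> h s = (LINT u|lborel. f (s / u) * p u)"
    and hlim: "filterlim (\<lambda>s. h s / s) at_top (at_right 0)"
  shows "regvar_0 \<alpha> h"
  unfolding regvar_0_def
proof (intro allI impI)
  fix c :: real assume c: "0 < c"
  have [measurable]: "p \<in> borel_measurable borel" using p(1) by auto
  have int: "integrable lborel (\<lambda>u. f (g u) * p u)" if [measurable]: "g \<in> borel_measurable borel" for g
  proof (rule Bochner_Integration.integrable_bound[OF p(1)])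
    show "AE u in lborel. norm (f (g u) * p u) \<le> norm (p u)"
      using f01 p by (auto simp: abs_mult intro!: mult_left_le_one_le)
  qed simp
  have B: "0 \<le> B" using p(2)[of 0] p(3)[of 0] by simp
  have key: "\<exists>K. eventually (\<lambda>s. \<bar>h (c * s) - c powr \<alpha> * h s\<bar> \<le> e * h s + K * s) (at_right 0)"
    if e: "0 < e" for e
  proof -
    have "eventually (\<lambda>s. dist (f (c * s) / f s) (c powr \<alpha>) < e) (at_right 0)"
      using regvar_0D[OF rv c] e by (rule tendstoD)
    with regvar_0_eventually_nonzero[OF rv]
    have "eventually (\<lambda>s. \<bar>f (c * s) - c powr \<alpha> * f s\<bar> \<le> e * f s) (at_right 0)"
    proof eventually_elim
      case (elim s)
      then have "0 < f s" using f01(1)[of s] by linarith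
      then have "\<bar>f (c * s) - c powr \<alpha> * f s\<bar> = dist (f (c * s) / f s) (c powr \<alpha>) * f s"
      proof -
        have "f (c * s) - c powr \<alpha> * f s = (f (c * s) / f s - c powr \<alpha>) * f s"
          using \<open>0 < f s\<close> by (simp add: left_diff_distrib)
        then show ?thesis using \<open>0 < f s\<close> by (simp only: abs_mult abs_of_pos dist_real_def)
      qed
      also have "\<dots> \<le> e * f s" using elim \<open>0 < f s\<close> by (intro mult_right_mono) auto
      finally show ?case .
    qed
    then obtain d where d: "0 < d" "\<And>s. 0 < s \<Longrightarrow> s < d \<Longrightarrow> \<bar>f (c * s) - c powr \<alpha> * f s\<bar> \<le> e * f s"
      by (auto simp: eventually_at_right_field)
    \<comment> \<open>The bound of the integrand on \<open>{0..s/d}\<close> times the length of that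
      interval, divided by \<open>s\<close>.\<close>
    define K where "K = (1 + c powr \<alpha>) * B / d"
    have "\<bar>h (c * s) - c powr \<alpha> * h s\<bar> \<le> e * h s + K * s" if s: "0 < s" for s
    proof -
      have iind: "integrable lborel (\<lambda>u. (1 + c powr \<alpha>) * B * indicator {0..s/d} u)"
        by (intro integrable_mult_right integrable_real_indicator) (auto simp: emeasure_lborel_Icc_eq)
      have eq: "h (c * s) - c powr \<alpha> * h s = (LINT u|lborel. f (c * s / u) * p u - c powr \<alpha> * (f (s / u) * p u))"
        using int s c by (subst Bochner_Integration.integral_diff) (auto simp: h)
      have "\<bar>h (c * s) - c powr \<alpha> * h s\<bar> \<le> (LINT u|lborel. \<bar>f (c * s / u) * p u - c powr \<alpha> * (f (s / u) * p u)\<bar>)"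
        unfolding eq by (rule integral_abs_bound)
      also have "\<dots> \<le> (LINT u|lborel. e * (f (s / u) * p u) + (1 + c powr \<alpha>) * B * indicator {0..s/d} u)"
      proof (rule integral_mono)
        show "integrable lborel (\<lambda>u. \<bar>f (c * s / u) * p u - c powr \<alpha> * (f (s / u) * p u)\<bar>)"
          using int by (intro integrable_abs Bochner_Integration.integrable_diff integrable_mult_right) auto
        show "integrable lborel (\<lambda>u. e * (f (s / u) * p u) + (1 + c powr \<alpha>) * B * indicator {0..s/d} u)"
          using int iind by (intro Bochner_Integration.integrable_add integrable_mult_right) auto
        fix u
        have split: "\<bar>f (c * s / u) * p u - c powr \<alpha> * (f (s / u) * p u)\<bar> = \<bar>f (c * (s / u)) - c powr \<alpha> * f (s / u)\<bar> * p u"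
        proof -
          have "f (c * s / u) * p u - c powr \<alpha> * (f (s / u) * p u) = (f (c * (s / u)) - c powr \<alpha> * f (s / u)) * p u"
            by (simp add: algebra_simps)
          then show ?thesis using p(2)[of u] by (simp only: abs_mult abs_of_nonneg)
        qed
        consider "u \<le> 0" | "0 < u" "u \<le> s / d" | "u > s / d" "0 < u" by linarith
        then show "\<bar>f (c * s / u) * p u - c powr \<alpha> * (f (s / u) * p u)\<bar>
            \<le> e * (f (s / u) * p u) + (1 + c powr \<alpha>) * B * indicator {0..s/d} u"
        proof cases
          case 1
          then show ?thesis using p(4)[of u] B by (simp add: indicator_def)
        next
          case 2
          have "c powr \<alpha> * f (s / u) \<le> c powr \<alpha> * 1" using f01 by (intro mult_left_mono) auto
          moreover have "0 \<le> c powr \<alpha> * f (s / u)" using f01 by simp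
          ultimately have "\<bar>f (c * (s / u)) - c powr \<alpha> * f (s / u)\<bar> \<le> 1 + c powr \<alpha>"
            using f01[of "c * (s / u)"] by linarith
          then have "\<bar>f (c * (s / u)) - c powr \<alpha> * f (s / u)\<bar> * p u \<le> (1 + c powr \<alpha>) * B"
            using p by (intro mult_mono) auto
          moreover have "0 \<le> e * (f (s / u) * p u)" using e f01 p by simp
          ultimately show ?thesis unfolding split using 2 by simp
        next
          case 3
          have "s / u < d" using 3 d s by (simp add: field_simps)
          then have "\<bar>f (c * (s / u)) - c powr \<alpha> * f (s / u)\<bar> * p u \<le> (e * f (s / u)) * p u"
            using d(2)[of "s / u"] 3 s p by (intro mult_right_mono) auto
          then show ?thesis unfolding split using 3 by (simp add: mult.assoc)
        qed
      qed
      also have "\<dots> = e * h s + (1 + c powr \<alpha>) * B * (s / d)"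
        using int iind s d by (subst Bochner_Integration.integral_add) (auto simp: h)
      finally show ?thesis by (simp add: K_def)
    qed
    then show ?thesis by (intro exI[of _ K] eventually_at_rightI[of 0 1]) auto
  qed
  show "((\<lambda>s. h (c * s) / h s) \<longlongrightarrow> c powr \<alpha>) (at_right 0)"
  proof (rule tendstoI)
    fix e :: real assume e: "0 < e"
    obtain K where K: "eventually (\<lambda>s. \<bar>h (c * s) - c powr \<alpha> * h s\<bar> \<le> (e / 2) * h s + K * s) (at_right 0)"
      using key[of "e / 2"] e by auto
    \<comment> \<open>The bound 0 gives \<open>h s > 0\<close>, and \<open>2 * K / e\<close> makes
      \<open>K * s\<close> smaller than half of the allowed error \<open>e * h s\<close>.\<close>
    have "eventually (\<lambda>s. h s / s > max 0 (2 * K / e)) (at_right 0)"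
      using hlim unfolding filterlim_at_top_dense by blast
    with K eventually_at_right_less[of 0]
    show "eventually (\<lambda>s. dist (h (c * s) / h s) (c powr \<alpha>) < e) (at_right 0)"
    proof eventually_elim
      case (elim s)
      then have hs: "0 < h s" by (auto simp: zero_less_divide_iff)
      have "K * s < (e / 2) * h s" using elim e by (simp add: field_simps)
      then have "\<bar>h (c * s) - c powr \<alpha> * h s\<bar> < e * h s" using elim by linarith
      then have "\<bar>h (c * s) - c powr \<alpha> * h s\<bar> / h s < e" using hs by (simp add: field_simps)
      moreover have "\<bar>h (c * s) - c powr \<alpha> * h s\<bar> / h s = \<bar>h (c * s) / h s - c powr \<alpha>\<bar>"
      proof -
        have "h (c * s) / h s - c powr \<alpha> = (h (c * s) - c powr \<alpha> * h s) / h s"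
          using hs by (simp add: diff_divide_distrib)
        then show ?thesis using hs by (simp only: abs_divide abs_of_pos)
      qed
      ultimately show ?case by (simp add: dist_real_def)
    qed
  qed
qed

subsection \<open>Laplace transforms\<close>

text \<open>A multiple of \<open>\<bar>p u\<bar>\<close> dominates the integrand and stays
  integrable over the product with the probability measure \<open>M\<close>. Every mixture formula
  below exchanges integrals in this form.\<close>

lemma Fubini_bounded_kernel:
  fixes K :: "'a \<Rightarrow> 'b \<Rightarrow> real" and p :: "'b \<Rightarrow> real"
  assumes M: "prob_space M" and N: "sigma_finite_measure N"
    and K[measurable]: "(\<lambda>(x, u). K x u) \<in> borel_measurable (M \<Otimes>\<^sub>M N)"
    and KC: "\<And>x u. \<bar>K x u\<bar> \<le> C"
    and p: "integrable N p"
  shows "(LINT x|M. LINT u|N. K x u * p u) = (LINT u|N. (LINT x|M. K x u) * p u)"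
proof -
  interpret M: prob_space M by fact
  interpret N: sigma_finite_measure N by fact
  interpret P: pair_sigma_finite M N ..
  have [measurable]: "p \<in> borel_measurable N" using p by auto
  have bd: "\<bar>K x u * p u\<bar> \<le> C * \<bar>p u\<bar>" for x u
    using KC[of x u] by (simp add: abs_mult mult_right_mono)
  have Cp: "integrable N (\<lambda>u. C * \<bar>p u\<bar>)" using p by simp
  have inner: "integrable N (\<lambda>u. K x u * p u)" if "x \<in> space M" for x
  proof (rule Bochner_Integration.integrable_bound[OF Cp])
    show "(\<lambda>u. K x u * p u) \<in> borel_measurable N" using that by measurable
  qed (use bd in \<open>auto intro: order_trans[OF _ abs_ge_self]\<close>)
  have "integrable (M \<Otimes>\<^sub>M N) (\<lambda>(x, u). K x u * p u)"
  proof (rule P.Fubini_integrable)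
    show "AE x in M. integrable N (\<lambda>y. case (x, y) of (x, u) \<Rightarrow> K x u * p u)"
      using inner by auto
    show "integrable M (\<lambda>x. LINT y|N. norm (case (x, y) of (x, u) \<Rightarrow> K x u * p u))"
    proof (rule M.integrable_const_bound[where B = "LINT u|N. C * \<bar>p u\<bar>"])
      show "AE x in M. norm (LINT y|N. norm (case (x, y) of (x, u) \<Rightarrow> K x u * p u)) \<le> (LINT u|N. C * \<bar>p u\<bar>)"
      proof (rule AE_I2)
        fix x assume x: "x \<in> space M"
        have "(LINT y|N. \<bar>K x y * p y\<bar>) \<le> (LINT u|N. C * \<bar>p u\<bar>)"
          using inner[OF x] Cp bd by (intro integral_mono) auto
        then show "norm (LINT y|N. norm (case (x, y) of (x, u) \<Rightarrow> K x u * p u)) \<le> (LINT u|N. C * \<bar>p u\<bar>)"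
          by simp
      qed
    qed measurable
  qed measurable
  from P.Fubini_integral[OF this] show ?thesis by simp
qed

definition laplace_gap :: "real measure \<Rightarrow> real \<Rightarrow> real" where
  "laplace_gap M s = (LINT x|M. 1 - exp (- (s * x)))"

text \<open>The derivative of \<open>laplace_gap\<close> taken formally under the integral;
  \<open>laplace_gap_has_derivative\<close> shows that it is the true one.\<close>

definition laplace_gap_deriv :: "real measure \<Rightarrow> real \<Rightarrow> real" where
  "laplace_gap_deriv M s = (LINT x|M. x * exp (- (s * x)))"

lemma mult_exp_minus_le:
  fixes s x :: real
  assumes "0 < s"
  shows "x * exp (- (s * x)) \<le> 1 / s"
proof -
  have "s * x \<le> exp (s * x)" using exp_ge_add_one_self[of "s * x"] by linarith
  then show ?thesis using assms by (simp add: exp_minus field_simps)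
qed

lemma integrable_exp_minus_half_line:
  "integrable lborel (\<lambda>u::real. indicator {0<..} u * exp (- u) :: real)"
proof -
  have "integrable lborel (exponential_density 1)"
  proof (rule integrableI_nonneg)
    show "(\<integral>\<^sup>+ u. ennreal (exponential_density 1 u) \<partial>lborel) < \<infinity>"
      using prob_space.emeasure_space_1[OF prob_space_exponential_density[OF zero_less_one]] by (simp add: emeasure_density)
  qed (auto simp: exponential_density_def)
  then show ?thesis
    by (rule Bochner_Integration.integrable_bound) (auto simp: exponential_density_def indicator_def)
qed

locale distribution_ge_1 = real_distribution M for M :: "real measure" +
  assumes ge_1: "AE x in M. 1 \<le> x"
begin

lemma nonneg: "AE x in M. 0 \<le> x"
  using ge_1 by eventually_elim simp

lemma integrable_one_minus_exp: "0 \<le> s \<Longrightarrow> integrable M (\<lambda>x. 1 - exp (- (s * x)))"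
  by (rule integrable_const_bound[where B = 1]) (use nonneg in \<open>auto elim!: eventually_mono\<close>)

lemma integrable_mult_exp: "0 < s \<Longrightarrow> integrable M (\<lambda>x. x * exp (- (s * x)))"
  by (rule integrable_const_bound[where B = "1 / s"])
     (use nonneg mult_exp_minus_le[of s] in \<open>auto elim!: eventually_mono simp: abs_mult\<close>)

text \<open>As all mass sits on \<open>x \<ge> 1\<close>, the gap is at least
  \<open>1 - exp (- s)\<close>.\<close>

lemma laplace_gap_pos:
  assumes "0 < s"
  shows "0 < laplace_gap M s"
proof -
  have "0 < 1 - exp (- s)" using assms by simp
  also have "\<dots> = (LINT x|M. 1 - exp (- s))" using prob_space by simp
  also have "\<dots> \<le> laplace_gap M s"
    unfolding laplace_gap_def
    by (intro integral_mono_AE integrable_one_minus_exp)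
       (use ge_1 assms in \<open>auto elim!: eventually_mono\<close>)
  finally show ?thesis .
qed

text \<open>Concavity holds pointwise: \<open>exp v \<ge> 1 + v\<close> at
  \<open>v = - (y - x) * z\<close>, multiplied by \<open>exp (- (x * z))\<close>, is the tangent
  inequality for the integrand.\<close>

lemma laplace_gap_tangent:
  assumes "0 < x" "0 < y"
  shows "laplace_gap M y \<le> laplace_gap M x + laplace_gap_deriv M x * (y - x)"
proof -
  have int: "integrable M (\<lambda>z. z * exp (- (x * z)) * (y - x))"
    by (intro integrable_mult_left integrable_mult_exp assms)
  have "laplace_gap M y \<le> (LINT z|M. (1 - exp (- (x * z))) + z * exp (- (x * z)) * (y - x))"
    unfolding laplace_gap_def
  proof (rule integral_mono)
    fix z
    have "exp (- (x * z)) * (1 + - (y - x) * z) \<le> exp (- (x * z)) * exp (- (y - x) * z)"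
      by (intro mult_left_mono exp_ge_add_one_self) auto
    also have "\<dots> = exp (- (y * z))" by (simp add: mult_exp_exp algebra_simps)
    finally show "1 - exp (- (y * z)) \<le> (1 - exp (- (x * z))) + z * exp (- (x * z)) * (y - x)"
      by (simp add: algebra_simps)
  qed (use int assms integrable_one_minus_exp in auto)
  also have "\<dots> = laplace_gap M x + laplace_gap_deriv M x * (y - x)"
    unfolding laplace_gap_def laplace_gap_deriv_def
    using int assms integrable_one_minus_exp integrable_mult_exp
    by (subst Bochner_Integration.integral_add) auto
  finally show ?thesis .
qed

lemma isCont_laplace_gap_deriv:
  assumes "0 < x"
  shows "isCont (laplace_gap_deriv M) x"
proof -
  define a where "a = x / 2"
  have a: "0 < a" "a < x" using assms by (auto simp: a_def)
  \<comment> \<open>Replacing \<open>t\<close> by \<open>max a t\<close> keeps the exponent away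
    from 0, so the constant \<open>1 / a\<close> dominates along any sequence; near
    \<open>x > a\<close> the truncation changes nothing.\<close>
  have "isCont (\<lambda>t. LINT z|M. z * exp (- (max a t * z))) x"
    unfolding continuous_at_sequentially
  proof safe
    fix X assume X: "X \<longlonglongrightarrow> x"
    show "((\<lambda>t. LINT z|M. z * exp (- (max a t * z))) \<circ> X) \<longlonglongrightarrow> (LINT z|M. z * exp (- (max a x * z)))"
      unfolding comp_def
    proof (rule integral_dominated_convergence[where w = "\<lambda>_. 1 / a"])
      show "AE z in M. norm (z * exp (- (max a (X i) * z))) \<le> 1 / a" for i
        using nonneg
      proof eventually_elim
        case (elim z)
        have "z * exp (- (max a (X i) * z)) \<le> z * exp (- (a * z))"
          using elim by (intro mult_left_mono) (auto intro: mult_right_mono)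
        then show ?case using elim mult_exp_minus_le[OF a(1), of z] by (simp add: abs_mult)
      qed
    qed (auto intro!: tendsto_intros X)
  qed
  moreover have "eventually (\<lambda>t. (LINT z|M. z * exp (- (max a t * z))) = laplace_gap_deriv M t) (nhds x)"
    using eventually_nhds_in_open[of "{a<..}" x] a
    by (auto elim!: eventually_mono simp: laplace_gap_deriv_def max_def)
  ultimately show ?thesis
    by (simp add: isCont_cong)
qed

text \<open>Differentiability comes from concavity: each difference quotient lies between the
  slopes at its two end points, and the slope is continuous.\<close>

lemma laplace_gap_has_derivative:
  assumes x: "0 < x"
  shows "(laplace_gap M has_real_derivative laplace_gap_deriv M x) (at x)"
  unfolding has_field_derivative_iff
proof (rule tendsto_sandwich)
  let ?D = "laplace_gap_deriv M" and ?h = "laplace_gap M"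
  have D: "(?D \<longlongrightarrow> ?D x) (at x)"
    using isCont_laplace_gap_deriv[OF x] by (simp add: isCont_def)
  show "((\<lambda>y. min (?D x) (?D y)) \<longlongrightarrow> ?D x) (at x)"
    using tendsto_min[OF tendsto_const D, of "?D x"] by simp
  show "((\<lambda>y. max (?D x) (?D y)) \<longlongrightarrow> ?D x) (at x)"
    using tendsto_max[OF tendsto_const D, of "?D x"] by simp
  have "eventually (\<lambda>y. 0 < y \<and> y \<noteq> x) (at x)"
    using eventually_at_in_open[of "{0<..}" x] x by (auto elim!: eventually_mono)
  then have *: "eventually (\<lambda>y. min (?D x) (?D y) \<le> (?h y - ?h x) / (y - x) \<and>
      (?h y - ?h x) / (y - x) \<le> max (?D x) (?D y)) (at x)"
  proof eventually_elim
    case (elim y)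
    have t: "?h y \<le> ?h x + ?D x * (y - x)" "?h x \<le> ?h y + ?D y * (x - y)"
      using laplace_gap_tangent elim x by auto
    show ?case
    proof (cases "x < y")
      case True
      then have "?D y \<le> (?h y - ?h x) / (y - x)" "(?h y - ?h x) / (y - x) \<le> ?D x"
        using t by (auto simp: field_simps)
      then show ?thesis by linarith
    next
      case False
      then have "?D x \<le> (?h y - ?h x) / (y - x)" "(?h y - ?h x) / (y - x) \<le> ?D y"
        using t elim by (auto simp: field_simps)
      then show ?thesis by linarith
    qed
  qed
  show "eventually (\<lambda>y. min (?D x) (?D y) \<le> (?h y - ?h x) / (y - x)) (at x)"
    using * by eventually_elim simp
  show "eventually (\<lambda>y. (?h y - ?h x) / (y - x) \<le> max (?D x) (?D y)) (at x)"
    using * by eventually_elim simp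
qed

lemma laplace_transform_eq_gap:
  assumes "0 \<le> s"
  shows "laplace_transform M s = 1 - laplace_gap M s"
proof -
  have "integrable M (\<lambda>x. exp (- s * x))"
    by (rule integrable_const_bound[where B = 1])
       (use nonneg assms in \<open>auto elim!: eventually_mono\<close>)
  then show ?thesis
    unfolding laplace_transform_def laplace_gap_def using prob_space by simp
qed

lemma deriv_laplace_transform:
  assumes "0 < s"
  shows "deriv (laplace_transform M) s = - laplace_gap_deriv M s"
proof (rule DERIV_imp_deriv)
  have "((\<lambda>s. 1 - laplace_gap M s) has_real_derivative - laplace_gap_deriv M s) (at s)"
    using laplace_gap_has_derivative[OF assms] by (auto intro!: derivative_eq_intros)
  \<comment> \<open>\<open>laplace_transform_eq_gap\<close> covers nonnegative arguments only, so
    the derivative is transferred on a neighbourhood of \<open>s\<close> inside the positive half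
    line.\<close>
  moreover have "eventually (\<lambda>t. 1 - laplace_gap M t = laplace_transform M t) (nhds s)"
    using eventually_nhds_in_open[of "{0<..}" s] assms
    by (auto elim!: eventually_mono simp: laplace_transform_eq_gap)
  ultimately show "(laplace_transform M has_real_derivative - laplace_gap_deriv M s) (at s)"
    using DERIV_cong_ev[OF refl _ refl] by fast
qed

lemma laplace_log_derivative_eq:
  assumes "0 < s"
  shows "- (s * deriv (laplace_transform M) s / (1 - laplace_transform M s))
    = s * laplace_gap_deriv M s / laplace_gap M s"
  using assms by (simp add: deriv_laplace_transform laplace_transform_eq_gap)

text \<open>The upper bound is \<open>(1 + v) * exp (- v) \<le> 1\<close> at
  \<open>v = s * x\<close>, integrated.\<close>

lemma laplace_log_derivative_bounds:
  assumes "0 < s"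
  shows "0 \<le> s * laplace_gap_deriv M s / laplace_gap M s"
    and "s * laplace_gap_deriv M s / laplace_gap M s \<le> 1"
proof -
  have "0 \<le> laplace_gap_deriv M s"
    unfolding laplace_gap_deriv_def by (rule integral_nonneg_AE) (use nonneg in auto)
  then show "0 \<le> s * laplace_gap_deriv M s / laplace_gap M s"
    using laplace_gap_pos[OF assms] assms by simp
  have "s * laplace_gap_deriv M s = (LINT x|M. s * (x * exp (- (s * x))))"
    unfolding laplace_gap_deriv_def by simp
  also have "\<dots> \<le> laplace_gap M s"
    unfolding laplace_gap_def
  proof (rule integral_mono)
    fix x
    have "(1 + s * x) * exp (- (s * x)) \<le> exp (s * x) * exp (- (s * x))"
      by (intro mult_right_mono exp_ge_add_one_self) auto
    then show "s * (x * exp (- (s * x))) \<le> 1 - exp (- (s * x))"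
      by (simp add: mult_exp_exp algebra_simps)
  qed (use assms integrable_mult_exp integrable_one_minus_exp in auto)
  finally show "s * laplace_gap_deriv M s / laplace_gap M s \<le> 1"
    using laplace_gap_pos[OF assms] by simp
qed

text \<open>Expand the square of \<open>1 - exp (- (s * x))\<close>, which is nonnegative, and
  integrate.\<close>

lemma laplace_gap_double_le:
  assumes "0 \<le> s"
  shows "laplace_gap M (2 * s) \<le> 2 * laplace_gap M s"
proof -
  have "laplace_gap M (2 * s) \<le> (LINT x|M. 2 * (1 - exp (- (s * x))))"
    unfolding laplace_gap_def
  proof (rule integral_mono)
    fix x
    have "0 \<le> (1 - exp (- (s * x)))\<^sup>2" by simp
    also have "\<dots> = 1 - 2 * exp (- (s * x)) + exp (- (2 * s * x))"
      by (simp add: power2_eq_square algebra_simps mult_exp_exp)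
    finally show "1 - exp (- (2 * s * x)) \<le> 2 * (1 - exp (- (s * x)))" by simp
  qed (use assms integrable_one_minus_exp[of s] integrable_one_minus_exp[of "2 * s"]
      integrable_mult_right[OF integrable_one_minus_exp[of s], of 2] in \<open>auto simp del: integrable_mult_right_iff\<close>)
  then show ?thesis unfolding laplace_gap_def by (simp only: integral_mult_right_zero)
qed

text \<open>Dominated convergence with bound 1, after the substitution \<open>s = inverse t\<close>
  that moves the limit from 0 to infinity.\<close>

lemma laplace_gap_tendsto_0: "(laplace_gap M \<longlongrightarrow> 0) (at_right 0)"
  unfolding filterlim_at_right_to_top laplace_gap_def
proof -
  have "((\<lambda>t. LINT x|M. 1 - exp (- (inverse t * x))) \<longlongrightarrow> (LINT x|M. 0)) at_top"
  proof (rule integral_dominated_convergence_at_top[where w = "\<lambda>_. 1"])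
    show "\<forall>\<^sub>F t in at_top. AE x in M. norm (1 - exp (- (inverse t * x))) \<le> 1"
      using eventually_gt_at_top[of 0]
      by eventually_elim (use nonneg in \<open>auto elim!: eventually_mono\<close>)
    have "((\<lambda>t. 1 - exp (- (inverse t * x))) \<longlongrightarrow> 1 - exp (- (0 * x))) at_top" for x :: real
      by (intro tendsto_intros tendsto_inverse_0_at_top filterlim_ident)
    then show "AE x in M. ((\<lambda>t. 1 - exp (- (inverse t * x))) \<longlongrightarrow> 0) at_top" by simp
  qed auto
  then show "((\<lambda>t. LINT x|M. 1 - exp (- (inverse t * x))) \<longlongrightarrow> 0) at_top" by simp
qed

section \<open>The gap near zero for finite and for infinite mean\<close>

lemma laplace_gap_le_mean:
  assumes "integrable M (\<lambda>x. x)" "0 \<le> s"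
  shows "laplace_gap M s \<le> (LINT x|M. x) * s"
proof -
  have "laplace_gap M s \<le> (LINT x|M. x * s)"
    unfolding laplace_gap_def
  proof (rule integral_mono)
    show "1 - exp (- (s * x)) \<le> x * s" for x
      using exp_ge_add_one_self[of "- (s * x)"] by (simp add: mult.commute)
  qed (use assms integrable_one_minus_exp in auto)
  then show ?thesis by simp
qed

text \<open>By dominated convergence with bound \<open>x\<close>, the quotient of the gap by
  \<open>s\<close> tends to the mean, which is at least 1; so the gap inherits index 1 from the
  identity.\<close>

lemma regvar_0_laplace_gap_finite_mean:
  assumes int: "integrable M (\<lambda>x. x)"
  shows "regvar_0 1 (laplace_gap M)"
proof (rule regvar_0_cong_ratio)
  show "regvar_0 1 (\<lambda>s. s)"
    unfolding regvar_0_def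
  proof (intro allI impI)
    fix c :: real assume "0 < c"
    have "eventually (\<lambda>s. c = c * s / s) (at_right 0)"
      using eventually_at_right_less[of 0] by eventually_elim simp
    then have "((\<lambda>s. c * s / s) \<longlongrightarrow> c) (at_right 0)"
      by (rule Lim_transform_eventually[OF tendsto_const])
    then show "((\<lambda>s. c * s / s) \<longlongrightarrow> c powr 1) (at_right 0)" using \<open>0 < c\<close> by simp
  qed
  have "1 = (LINT x|M. 1 :: real)" by (simp add: prob_space del: space_eq_univ)
  also have "\<dots> \<le> (LINT x|M. x)" using ge_1 int by (intro integral_mono_AE) auto
  finally show "(LINT x|M. x) \<noteq> 0" by simp
  have "((\<lambda>t. LINT x|M. (1 - exp (- (inverse t * x))) / inverse t) \<longlongrightarrow> (LINT x|M. x)) at_top"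
  proof (rule integral_dominated_convergence_at_top[where w = "\<lambda>x. x"])
    show "\<forall>\<^sub>F t in at_top. AE x in M. norm ((1 - exp (- (inverse t * x))) / inverse t) \<le> x"
      using eventually_gt_at_top[of 0]
    proof eventually_elim
      case (elim t)
      show ?case using nonneg
      proof eventually_elim
        case (elim x)
        have "1 - exp (- (inverse t * x)) \<le> inverse t * x"
          using exp_ge_add_one_self[of "- (inverse t * x)"] by simp
        then show ?case using elim \<open>0 < t\<close> by (simp add: field_simps)
      qed
    qed
    have "((\<lambda>t. (1 - exp (- (inverse t * x))) / inverse t) \<longlongrightarrow> x) at_top" for x :: real
    proof -
      have "((\<lambda>s. 1 - exp (- (s * x))) has_real_derivative x) (at 0)"
        by (auto intro!: derivative_eq_intros)
      then have "((\<lambda>s. (1 - exp (- (s * x))) / s) \<longlongrightarrow> x) (at 0)"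
        by (simp add: has_field_derivative_iff)
      then have "((\<lambda>s. (1 - exp (- (s * x))) / s) \<longlongrightarrow> x) (at_right 0)"
        by (rule filterlim_mono) (auto simp: at_le)
      then show ?thesis by (simp add: filterlim_at_right_to_top)
    qed
    then show "AE x in M. ((\<lambda>t. (1 - exp (- (inverse t * x))) / inverse t) \<longlongrightarrow> x) at_top" by simp
    show "(\<lambda>x. x) \<in> borel_measurable M" by simp
    show "(\<lambda>x. (1 - exp (- (inverse t * x))) / inverse t) \<in> borel_measurable M" for t by simp
    show "integrable M (\<lambda>x. x)" by (rule int)
  qed
  moreover have "(LINT x|M. (1 - exp (- (inverse t * x))) / inverse t) = laplace_gap M (inverse t) / inverse t" for t
    unfolding laplace_gap_def by (rule integral_divide_zero)
  ultimately have "((\<lambda>t. laplace_gap M (inverse t) / inverse t) \<longlongrightarrow> (LINT x|M. x)) at_top"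
    by (simp only:)
  then show "((\<lambda>s. laplace_gap M s / s) \<longlongrightarrow> (LINT x|M. x)) (at_right 0)"
    unfolding filterlim_at_right_to_top .
qed

text \<open>The truncated means \<open>m n\<close> are unbounded, since otherwise monotone
  convergence would make the mean finite. The estimate
  \<open>1 - exp (- v) \<ge> v - v^2 / 2\<close> at \<open>v = s * min x n\<close> bounds the
  quotient below by \<open>m n - s * n^2 / 2\<close>, which tends to \<open>m n\<close>.\<close>

lemma laplace_gap_quotient_infinite_mean:
  assumes nint: "\<not> integrable M (\<lambda>x. x)"
  shows "filterlim (\<lambda>s. laplace_gap M s / s) at_top (at_right 0)"
  unfolding filterlim_at_top
proof
  fix Z :: real
  define m where "m n = (LINT x|M. min x (real n))" for n
  have imin: "integrable M (\<lambda>x. min x (real n))" for n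
    by (rule integrable_const_bound[where B = "real n"]) (use nonneg in \<open>auto elim!: eventually_mono\<close>)
  have mono_m: "incseq m"
    unfolding m_def incseq_def by (auto intro!: integral_mono imin)
  have "\<exists>n. m n > Z + 1"
  proof (rule ccontr)
    assume "\<not> ?thesis"
    then have "bdd_above (range m)" by (auto simp: not_less intro!: bdd_aboveI)
    then have lim: "m \<longlonglongrightarrow> (SUP n. m n)" using mono_m by (rule LIMSEQ_incseq_SUP)
    have "integrable M (\<lambda>x. x)"
    proof (rule integrable_monotone_convergence[OF imin])
      show "AE x in M. mono (\<lambda>n. min x (real n))"
        by (auto simp: mono_def)
      have "(\<lambda>n. min x (real n)) \<longlonglongrightarrow> x" for x
      proof (rule tendsto_eventually)
        obtain N :: nat where "x \<le> real N" using real_arch_simple by blast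
        then show "\<forall>\<^sub>F n in sequentially. min x (real n) = x"
          by (intro eventually_sequentiallyI[of N]) auto
      qed
      then show "AE x in M. (\<lambda>n. min x (real n)) \<longlonglongrightarrow> x" by simp
      show "(\<lambda>n. LINT x|M. min x (real n)) \<longlonglongrightarrow> (SUP n. m n)" using lim unfolding m_def .
    qed simp
    with nint show False by simp
  qed
  then obtain n where n: "m n > Z + 1" by auto
  have bound: "m n - s * (real n)\<^sup>2 / 2 \<le> laplace_gap M s / s" if s: "0 < s" for s
  proof -
    have "s * m n - s\<^sup>2 * (real n)\<^sup>2 / 2 = (LINT x|M. s * min x (real n) - s\<^sup>2 * (real n)\<^sup>2 / 2)"
      unfolding m_def using imin prob_space by simp
    also have "\<dots> \<le> laplace_gap M s"
      unfolding laplace_gap_def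
    proof (rule integral_mono_AE)
      show "AE x in M. s * min x (real n) - s\<^sup>2 * (real n)\<^sup>2 / 2 \<le> 1 - exp (- (s * x))"
        using nonneg
      proof eventually_elim
        case (elim x)
        define y where "y = min x (real n)"
        have y: "0 \<le> y" "y \<le> real n" "y \<le> x" using elim by (auto simp: y_def)
        have "exp (- (s * x)) \<le> exp (- (s * y))" using y s by simp
        \<comment> \<open>For \<open>v = s * y\<close> the product of \<open>1 - v + v^2 / 2\<close>
          and \<open>1 + v + v^2 / 2\<close> is \<open>1 + v^4 / 4\<close>, and the second factor is
          at most \<open>exp v\<close>.\<close>
        also have "\<dots> \<le> 1 - s * y + (s * y)\<^sup>2 / 2"
        proof -
          have "1 + s * y + (s * y)\<^sup>2 / 2 \<le> exp (s * y)"
            using exp_lower_Taylor_quadratic[of "s * y"] y s by simp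
          moreover have "1 \<le> (1 - s * y + (s * y)\<^sup>2 / 2) * (1 + s * y + (s * y)\<^sup>2 / 2)"
          proof -
            have "(1 - s * y + (s * y)\<^sup>2 / 2) * (1 + s * y + (s * y)\<^sup>2 / 2) = 1 + ((s * y)\<^sup>2)\<^sup>2 / 4"
              by (simp add: power2_eq_square algebra_simps)
            then show ?thesis by simp
          qed
          moreover have "0 \<le> 1 - s * y + (s * y)\<^sup>2 / 2"
          proof -
            have "2 * (1 - s * y + (s * y)\<^sup>2 / 2) = (1 - s * y)\<^sup>2 + 1"
              by (simp add: power2_eq_square algebra_simps)
            then show ?thesis by (smt (verit) zero_le_power2)
          qed
          ultimately have "1 \<le> (1 - s * y + (s * y)\<^sup>2 / 2) * exp (s * y)"
            by (meson mult_left_mono order_trans)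
          then show ?thesis by (simp add: exp_minus field_simps)
        qed
        also have "(s * y)\<^sup>2 / 2 \<le> s\<^sup>2 * (real n)\<^sup>2 / 2"
          using y by (auto simp: power_mult_distrib intro!: mult_left_mono power_mono)
        finally show ?case by (simp add: y_def)
      qed
    qed (use imin integrable_one_minus_exp s in auto)
    finally show ?thesis using s by (simp add: field_simps power2_eq_square)
  qed
  have "((\<lambda>s. m n - s * (real n)\<^sup>2 / 2) \<longlongrightarrow> m n - 0 * (real n)\<^sup>2 / 2) (at_right 0)"
    by (intro tendsto_intros) auto
  then have "eventually (\<lambda>s. m n - s * (real n)\<^sup>2 / 2 > Z) (at_right 0)"
    by (rule order_tendstoD) (use n in simp)
  with eventually_at_right_less[of 0]
  show "eventually (\<lambda>s. Z \<le> laplace_gap M s / s) (at_right 0)"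
    by eventually_elim (use bound in force)
qed

text \<open>\<open>1 - exp (- (s * x))\<close> is the integral of \<open>exp (- u)\<close> over
  \<open>0 < u\<close> and \<open>u / s < x\<close>; exchanging integrals leaves the tail at
  \<open>u / s\<close>. It is written \<open>1 / (s / u)\<close> to have the shape
  \<open>f (s / u)\<close> of \<open>regvar_0_mixture\<close>.\<close>

lemma laplace_gap_eq_tail_mixture:
  assumes s: "0 < s"
  shows "laplace_gap M s = (LINT u|lborel. measure M {1 / (s / u)<..} * (indicator {0<..} u * exp (- u)))"
proof -
  let ?p = "\<lambda>u::real. indicator {0<..} u * exp (- u) :: real"
  have eq: "1 - exp (- (s * x)) = (LINT u|lborel. indicator {u. u / s < x} u * ?p u)" if x: "0 \<le> x" for x
  proof -
    have "(LINT u:{0..s * x}|lborel. exp (- u)) = - exp (- (s * x)) - - exp (- 0)"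
      unfolding set_lebesgue_integral_def
    proof (rule integral_FTC_atLeastAtMost)
      show "((\<lambda>u. - exp (- u)) has_vector_derivative exp (- u)) (at u within {0..s * x})" for u :: real
        unfolding has_real_derivative_iff_has_vector_derivative[symmetric]
        by (auto intro!: derivative_eq_intros)
    qed (use s x in \<open>auto intro!: continuous_intros\<close>)
    moreover have "(LINT u|lborel. indicator {u. u / s < x} u * ?p u) = (LINT u:{0..s * x}|lborel. exp (- u))"
      unfolding set_lebesgue_integral_def
    proof (rule integral_cong_AE)
      show "AE u in lborel. indicator {u. u / s < x} u * ?p u = indicator {0..s * x} u *\<^sub>R exp (- u)"
        using AE_lborel_singleton[of 0] AE_lborel_singleton[of "s * x"]
        by eventually_elim (use s in \<open>auto simp: indicator_def field_simps\<close>)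
    qed measurable
    ultimately show ?thesis by simp
  qed
  have "laplace_gap M s = (LINT x|M. LINT u|lborel. indicator {u. u / s < x} u * ?p u)"
    unfolding laplace_gap_def by (rule integral_cong_AE) (use nonneg eq in \<open>auto elim!: eventually_mono\<close>)
  also have "\<dots> = (LINT u|lborel. (LINT x|M. indicator {u. u / s < x} u) * ?p u)"
    by (rule Fubini_bounded_kernel[OF prob_space_axioms sigma_finite_lborel _ _ integrable_exp_minus_half_line, where C = 1]) (auto simp: indicator_def)
  also have "\<dots> = (LINT u|lborel. measure M {u / s<..} * ?p u)"
  proof (rule Bochner_Integration.integral_cong[OF refl])
    fix u
    have "(LINT x|M. indicator {u. u / s < x} u) = (LINT x|M. indicator {u / s<..} x :: real)"
      by (rule Bochner_Integration.integral_cong) (auto simp: indicator_def)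
    then show "(LINT x|M. indicator {u. u / s < x} u) * ?p u = measure M {u / s<..} * ?p u" by simp
  qed
  finally show ?thesis by simp
qed

end

subsection \<open>Gaussian mixtures and symmetrization\<close>

text \<open>The density of the absolute value of a standard normal variable, one-sided because
  \<open>regvar_0_mixture\<close> asks for a density that vanishes for
  \<open>u \<le> 0\<close>.\<close>

definition half_normal_density :: "real \<Rightarrow> real" where
  "half_normal_density w = indicator {0<..} w * (2 * std_normal_density w)"

lemma half_normal_density_measurable [measurable]: "half_normal_density \<in> borel_measurable borel"
  unfolding half_normal_density_def by measurable

lemma half_normal_density_bounds: "0 \<le> half_normal_density w" "half_normal_density w \<le> 2"
proof -
  show "0 \<le> half_normal_density w" by (simp add: half_normal_density_def)
  have "sqrt (2 * pi) \<ge> 1" using pi_ge_two by (intro real_le_rsqrt) simp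
  then have "1 / sqrt (2 * pi) \<le> 1" by simp
  moreover have "exp (- w\<^sup>2 / 2) \<le> 1" by simp
  ultimately have "std_normal_density w \<le> 1 * 1"
    unfolding std_normal_density_def by (intro mult_mono) auto
  then show "half_normal_density w \<le> 2" by (simp add: half_normal_density_def indicator_def)
qed

lemma integrable_half_normal_density: "integrable lborel half_normal_density"
proof (rule Bochner_Integration.integrable_bound)
  show "integrable lborel (\<lambda>w. 2 * std_normal_density w)" by simp
  show "AE w in lborel. norm (half_normal_density w) \<le> norm (2 * std_normal_density w)"
    by (auto simp: half_normal_density_def indicator_def)
qed simp

lemma integral_half_normal_density: "(LINT w|lborel. half_normal_density w) = 1"
proof -
  have "(LINT w|lborel. half_normal_density w) = (LINT w|lborel. half_normal_density (- w))"
    using lborel_integral_real_affine[of "-1" half_normal_density 0] by simp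
  then have "2 * (LINT w|lborel. half_normal_density w) =
      (LINT w|lborel. half_normal_density w) + (LINT w|lborel. half_normal_density (- w))" by simp
  also have "\<dots> = (LINT w|lborel. half_normal_density w + half_normal_density (- w))"
    using integrable_half_normal_density lborel_integrable_real_affine[of half_normal_density "-1" 0]
    by (subst Bochner_Integration.integral_add) auto
  also have "\<dots> = (LINT w|lborel. 2 * std_normal_density w)"
  proof (rule integral_cong_AE)
    show "AE w in lborel. half_normal_density w + half_normal_density (- w) = 2 * std_normal_density w"
      using AE_lborel_singleton[of 0]
      by eventually_elim (auto simp: half_normal_density_def std_normal_density_def indicator_def)
  qed measurable
  also have "\<dots> = 2" by simp
  finally show ?thesis by simp
qed

text \<open>The Cauchy--Schloemilch substitution: \<open>w \<mapsto> w - a / w\<close> maps the half line onto the line,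
  and \<open>w \<mapsto> a / w\<close> exchanges the two parts \<open>1\<close> and \<open>a / w\<^sup>2\<close> of its derivative.\<close>

lemma gaussian_subordination_pos:
  assumes a: "0 < a"
  shows "(LINT w|lborel. exp (- ((a / w)\<^sup>2 / 2)) * half_normal_density w) = exp (- a)"
proof -
  let ?\<phi> = std_normal_density
  define A where "A w = ?\<phi> (w - a / w)" for w
  have phi: "?\<phi> absolutely_integrable_on UNIV \<and> integral UNIV ?\<phi> = 1"
  proof
    show "?\<phi> absolutely_integrable_on UNIV"
      unfolding set_integrable_def by (auto simp: integrable_completion)
    have "(?\<phi> has_integral (LINT x|lborel. ?\<phi> x)) UNIV"
      by (rule has_integral_integral_lborel) simp
    then show "integral UNIV ?\<phi> = 1" by (simp add: integral_unique)
  qed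
  have img1: "(\<lambda>w. w - a / w) ` {0<..} = UNIV"
  proof (rule set_eqI, rule iffI)
    fix y :: real
    \<comment> \<open>The positive root of \<open>w^2 - y * w - a = 0\<close>.\<close>
    define w where "w = (y + sqrt (y\<^sup>2 + 4 * a)) / 2"
    have "\<bar>y\<bar> < sqrt (y\<^sup>2 + 4 * a)" using a by (intro real_less_rsqrt) simp
    then have "0 < y + sqrt (y\<^sup>2 + 4 * a)" using abs_ge_minus_self[of y] by linarith
    then have w: "0 < w" unfolding w_def by simp
    have "(sqrt (y\<^sup>2 + 4 * a))\<^sup>2 = y\<^sup>2 + 4 * a" using a by simp
    moreover have "sqrt (y\<^sup>2 + 4 * a) = 2 * w - y" by (simp add: w_def field_simps)
    ultimately have "(2 * w - y)\<^sup>2 = y\<^sup>2 + 4 * a" by metis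
    then have "w * w - a = y * w" by (simp add: power2_eq_square algebra_simps)
    then have "w - a / w = y" using w by (simp add: field_simps)
    then show "y \<in> (\<lambda>w. w - a / w) ` {0<..}" using w by force
  qed simp
  have "inj_on (\<lambda>w. w - a / w) {0<..}"
  proof (rule linorder_inj_onI')
    fix v w :: real assume vw: "v \<in> {0<..}" "w \<in> {0<..}" "v < w"
    then have "a / w < a / v" using a by (intro divide_strict_left_mono) auto
    then show "v - a / v \<noteq> w - a / w" using vw by linarith
  qed
  then have 1: "(\<lambda>w. \<bar>1 + a / w\<^sup>2\<bar> * ?\<phi> (w - a / w)) absolutely_integrable_on {0<..} \<and>
      integral {0<..} (\<lambda>w. \<bar>1 + a / w\<^sup>2\<bar> * ?\<phi> (w - a / w)) = 1"
    using phi
    by (subst has_absolute_integral_change_of_variables_1')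
       (auto simp: img1 power2_eq_square intro!: derivative_eq_intros)
  have [measurable]: "A \<in> borel_measurable borel" unfolding A_def by measurable
  have Aint: "A absolutely_integrable_on {0<..}"
  proof (rule measurable_bounded_by_integrable_imp_absolutely_integrable)
    show "(\<lambda>w. \<bar>1 + a / w\<^sup>2\<bar> * ?\<phi> (w - a / w)) integrable_on {0<..}"
      using 1 set_lebesgue_integral_eq_integral(1) by blast
    show "norm (A w) \<le> \<bar>1 + a / w\<^sup>2\<bar> * ?\<phi> (w - a / w)" for w
    proof -
      have "1 * ?\<phi> (w - a / w) \<le> \<bar>1 + a / w\<^sup>2\<bar> * ?\<phi> (w - a / w)"
        using a by (intro mult_right_mono) auto
      then show ?thesis by (simp add: A_def)
    qed
    show "A \<in> borel_measurable (lebesgue_on {0<..})"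
      by (intro measurable_restrict_space1 measurable_completion) simp
  qed simp
  have img2: "(\<lambda>w. a / w) ` {0<..} = {0<..}"
  proof (rule set_eqI, rule iffI)
    fix y :: real assume "y \<in> {0<..}"
    then have "y = a / (a / y)" "a / y \<in> {0<..}" using a by auto
    then show "y \<in> (\<lambda>w. a / w) ` {0<..}" by (rule image_eqI)
  qed (use a in auto)
  \<comment> \<open>Passing from \<open>w\<close> to \<open>a / w\<close> flips the sign of
    \<open>w - a / w\<close>, and the normal density is even.\<close>
  have symm: "A (a / w) = A w" if "0 < w" for w
    using that a by (simp add: A_def std_normal_density_def power2_commute)
  have "(\<lambda>w. \<bar>- (a / w\<^sup>2)\<bar> * A (a / w)) absolutely_integrable_on {0<..} \<and>
      integral {0<..} (\<lambda>w. \<bar>- (a / w\<^sup>2)\<bar> * A (a / w)) = integral {0<..} A \<longleftrightarrow>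
    A absolutely_integrable_on ((\<lambda>w. a / w) ` {0<..}) \<and>
      integral ((\<lambda>w. a / w) ` {0<..}) A = integral {0<..} A"
    by (rule has_absolute_integral_change_of_variables_1')
       (use a in \<open>auto simp: inj_on_def power2_eq_square intro!: derivative_eq_intros\<close>)
  then have "(\<lambda>w. \<bar>- (a / w\<^sup>2)\<bar> * A (a / w)) absolutely_integrable_on {0<..} \<and>
      integral {0<..} (\<lambda>w. \<bar>- (a / w\<^sup>2)\<bar> * A (a / w)) = integral {0<..} A"
    using Aint by (simp only: img2)
  moreover have "integral {0<..} (\<lambda>w. \<bar>- (a / w\<^sup>2)\<bar> * A (a / w)) = integral {0<..} (\<lambda>w. a / w\<^sup>2 * A w)"
    using a by (intro integral_cong) (auto simp: symm)
  moreover have "(\<lambda>w. \<bar>- (a / w\<^sup>2)\<bar> * A (a / w)) absolutely_integrable_on {0<..} \<longleftrightarrow>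
      (\<lambda>w. a / w\<^sup>2 * A w) absolutely_integrable_on {0<..}"
    using a by (intro set_integrable_cong) (auto simp: symm)
  ultimately have 2: "(\<lambda>w. a / w\<^sup>2 * A w) absolutely_integrable_on {0<..}"
      "integral {0<..} (\<lambda>w. a / w\<^sup>2 * A w) = integral {0<..} A" by auto
  \<comment> \<open>By \<open>2(2)\<close> both parts have the same integral, and they add up to 1,
    so each is one half.\<close>
  have "1 = integral {0<..} (\<lambda>w. A w + a / w\<^sup>2 * A w)"
    using 1 a by (auto simp: A_def algebra_simps cong: integral_cong)
  also have "\<dots> = integral {0<..} A + integral {0<..} (\<lambda>w. a / w\<^sup>2 * A w)"
    using Aint 2(1) set_lebesgue_integral_eq_integral(1) by (intro Henstock_Kurzweil_Integration.integral_add) blast+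
  finally have half: "integral {0<..} A = 1 / 2" using 2(2) by simp
  have "set_integrable lborel {0<..} A"
    using Aint unfolding set_integrable_def by (subst (asm) integrable_completion) auto
  then have "(LINT w:{0<..}|lborel. A w) = 1 / 2"
    using half set_borel_integral_eq_integral(2) by metis
  moreover have "(LINT w|lborel. exp (- ((a / w)\<^sup>2 / 2)) * half_normal_density w)
      = (LINT w|lborel. 2 * exp (- a) * (indicator {0<..} w *\<^sub>R A w))"
  proof (rule Bochner_Integration.integral_cong[OF refl])
    fix w :: real
    show "exp (- ((a / w)\<^sup>2 / 2)) * half_normal_density w = 2 * exp (- a) * (indicator {0<..} w *\<^sub>R A w)"
    proof (cases "0 < w")
      case True
      \<comment> \<open>Completing the square:
        \<open>w^2 + (a / w)^2 = (w - a / w)^2 + 2 * a\<close>.\<close>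
      then have "- ((a / w)\<^sup>2 / 2) + - w\<^sup>2 / 2 = - a + - (w - a / w)\<^sup>2 / 2"
        by (simp add: power2_eq_square field_simps)
      then have "exp (- ((a / w)\<^sup>2 / 2)) * exp (- w\<^sup>2 / 2) = exp (- a) * exp (- (w - a / w)\<^sup>2 / 2)"
        by (simp only: mult_exp_exp)
      then show ?thesis using True
        by (simp add: half_normal_density_def A_def std_normal_density_def field_simps)
    qed (simp add: half_normal_density_def)
  qed
  ultimately show ?thesis by (simp add: set_lebesgue_integral_def)
qed

lemma gaussian_subordination:
  assumes "0 \<le> a"
  shows "(LINT w|lborel. exp (- ((a / w)\<^sup>2 / 2)) * half_normal_density w) = exp (- a)"
proof (cases "a = 0")
  case True
  then show ?thesis by (simp add: integral_half_normal_density)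
qed (use assms gaussian_subordination_pos in simp)

text \<open>One minus the real part of the characteristic function.\<close>

definition cos_gap :: "real measure \<Rightarrow> real \<Rightarrow> real" where
  "cos_gap N t = (LINT y|N. 1 - cos (t * y))"

text \<open>The average of \<open>cos_gap\<close> over a standard normal factor. It is monotone for
  \<open>s \<ge> 0\<close>, as \<open>regvar_0_from_sequence\<close> requires.\<close>

definition gauss_gap :: "real measure \<Rightarrow> real \<Rightarrow> real" where
  "gauss_gap N s = (LINT y|N. 1 - exp (- ((s * y)\<^sup>2 / 2)))"

definition abs_laplace_gap :: "real measure \<Rightarrow> real \<Rightarrow> real" where
  "abs_laplace_gap N s = (LINT y|N. 1 - exp (- (s * \<bar>y\<bar>)))"

lemma integral_cos_std_normal: "(LINT u|lborel. cos (t * u) * std_normal_density u) = exp (- (t\<^sup>2 / 2))"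
proof -
  interpret real_distribution std_normal_distribution by (rule real_dist_normal_dist)
  have "(LINT u|std_normal_distribution. cos (t * u)) = (LINT u|std_normal_distribution. Re (iexp (t * u)))"
    by (simp add: Re_exp)
  also have "\<dots> = Re (char std_normal_distribution t)"
    unfolding char_def by (rule integral_Re) (rule integrable_iexp, auto)
  also have "\<dots> = exp (- (t\<^sup>2 / 2))"
    by (simp add: char_std_normal_distribution Re_exp)
  finally show ?thesis by (subst (asm) integral_density) (auto simp: mult.commute)
qed

context real_distribution
begin

lemma integrable_one_minus_cos: "integrable M (\<lambda>y. 1 - cos (t * y))"
proof (rule integrable_const_bound[where B = 2])
  have "\<bar>1 - cos (t * y)\<bar> \<le> 2" for y
    using cos_ge_minus_one[of "t * y"] cos_le_one[of "t * y"] by linarith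
  then show "AE y in M. norm (1 - cos (t * y)) \<le> 2" by simp
qed simp

lemma integrable_one_minus_gauss: "integrable M (\<lambda>y. 1 - exp (- ((s * y)\<^sup>2 / 2)))"
  by (rule integrable_const_bound[where B = 1]) auto

lemma integrable_one_minus_exp_abs: "0 \<le> s \<Longrightarrow> integrable M (\<lambda>y. 1 - exp (- (s * \<bar>y\<bar>)))"
  by (rule integrable_const_bound[where B = 1]) auto

lemma gauss_gap_nonneg: "0 \<le> gauss_gap M s"
  unfolding gauss_gap_def by (rule Bochner_Integration.integral_nonneg) simp

lemma gauss_gap_le_1: "gauss_gap M s \<le> 1"
  unfolding gauss_gap_def
  using integral_mono[OF integrable_one_minus_gauss[of s] integrable_const[of 1]] prob_space by simp

lemma gauss_gap_mono: "0 \<le> s \<Longrightarrow> s \<le> t \<Longrightarrow> gauss_gap M s \<le> gauss_gap M t"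
  unfolding gauss_gap_def
  by (intro integral_mono integrable_one_minus_gauss)
     (auto simp: power_mult_distrib intro!: mult_right_mono power_mono)

lemma gauss_gap_measurable [measurable]: "gauss_gap M \<in> borel_measurable borel"
  unfolding gauss_gap_def by measurable

text \<open>\<open>exp (- ((s * y)^2 / 2))\<close> is the mean of \<open>cos (s * y * W)\<close> for
  a standard normal \<open>W\<close>.\<close>

lemma gauss_gap_eq_integral_cos_gap:
  "gauss_gap M s = (LINT u|lborel. cos_gap M (s * u) * std_normal_density u)"
proof -
  have "1 - exp (- ((s * y)\<^sup>2 / 2)) = (LINT u|lborel. (1 - cos (s * u * y)) * std_normal_density u)" for y
  proof -
    have i: "integrable lborel (\<lambda>u. cos (s * y * u) * std_normal_density u)"
      by (rule Bochner_Integration.integrable_bound[of _ std_normal_density])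
         (auto simp: abs_mult mult_left_le_one_le)
    have "(LINT u|lborel. std_normal_density u - cos (s * y * u) * std_normal_density u)
        = 1 - exp (- ((s * y)\<^sup>2 / 2))"
      using i by (subst Bochner_Integration.integral_diff) (auto simp: integral_cos_std_normal)
    then show ?thesis by (simp add: algebra_simps)
  qed
  then have "gauss_gap M s = (LINT y|M. LINT u|lborel. (1 - cos (s * u * y)) * std_normal_density u)"
    unfolding gauss_gap_def by simp
  also have "\<dots> = (LINT u|lborel. cos_gap M (s * u) * std_normal_density u)"
    unfolding cos_gap_def
  proof (rule Fubini_bounded_kernel[OF prob_space_axioms sigma_finite_lborel, where C = 2])
    show "\<bar>1 - cos (s * u * y)\<bar> \<le> 2" for u y
      using cos_ge_minus_one[of "s * u * y"] cos_le_one[of "s * u * y"] by linarith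
  qed auto
  finally show ?thesis .
qed

text \<open>\<open>gaussian_subordination\<close> at \<open>a = s * \<bar>y\<bar>\<close> writes the
  Laplace kernel as a mixture of Gaussian kernels with scales \<open>s / w\<close>.\<close>

lemma abs_laplace_gap_eq_mixture:
  assumes s: "0 < s"
  shows "abs_laplace_gap M s = (LINT w|lborel. gauss_gap M (s / w) * half_normal_density w)"
proof -
  have "1 - exp (- (s * \<bar>y\<bar>)) = (LINT w|lborel. (1 - exp (- ((s / w * y)\<^sup>2 / 2))) * half_normal_density w)" for y
  proof -
    have i: "integrable lborel (\<lambda>w. exp (- ((s / w * y)\<^sup>2 / 2)) * half_normal_density w)"
      by (rule Bochner_Integration.integrable_bound[OF integrable_half_normal_density])
         (auto simp: abs_mult mult_left_le_one_le)
    have "(s / w * y)\<^sup>2 = (s * \<bar>y\<bar> / w)\<^sup>2" for w by (simp add: power_mult_distrib power_divide)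
    then have "(LINT w|lborel. exp (- ((s / w * y)\<^sup>2 / 2)) * half_normal_density w) = exp (- (s * \<bar>y\<bar>))"
      using gaussian_subordination[of "s * \<bar>y\<bar>"] s by simp
    then have "(LINT w|lborel. half_normal_density w - exp (- ((s / w * y)\<^sup>2 / 2)) * half_normal_density w)
        = 1 - exp (- (s * \<bar>y\<bar>))"
      using i integrable_half_normal_density
      by (subst Bochner_Integration.integral_diff) (auto simp: integral_half_normal_density)
    then show ?thesis by (simp add: algebra_simps)
  qed
  then have "abs_laplace_gap M s =
      (LINT y|M. LINT w|lborel. (1 - exp (- ((s / w * y)\<^sup>2 / 2))) * half_normal_density w)"
    unfolding abs_laplace_gap_def by simp
  also have "\<dots> = (LINT w|lborel. gauss_gap M (s / w) * half_normal_density w)"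
    unfolding gauss_gap_def
    by (rule Fubini_bounded_kernel[OF prob_space_axioms sigma_finite_lborel, where C = 1])
       (auto intro: integrable_half_normal_density)
  finally show ?thesis .
qed

text \<open>With \<open>z = (d * y)^2 / 2\<close>, the integrand \<open>1 - cos (u * y)\<close> is
  at most \<open>z\<close> and at most 2, while \<open>1 - exp (- z) \<ge> z / (1 + z)\<close> is at
  least half the minimum of \<open>z\<close> and 1. Hence the factor 4.\<close>

lemma cos_gap_le_gauss_gap:
  assumes "\<bar>u\<bar> \<le> d"
  shows "cos_gap M u \<le> 4 * gauss_gap M d"
proof -
  have "cos_gap M u \<le> (LINT y|M. 4 * (1 - exp (- ((d * y)\<^sup>2 / 2))))"
    unfolding cos_gap_def
  proof (rule integral_mono)
    fix y
    define z where "z = (d * y)\<^sup>2 / 2"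
    have z: "0 \<le> z" by (simp add: z_def)
    have "1 - cos (u * y) = 2 * (sin (u * y / 2))\<^sup>2"
      using cos_double_sin[of "u * y / 2"] by simp
    also have "(sin (u * y / 2))\<^sup>2 \<le> (u * y / 2)\<^sup>2"
      using abs_sin_le_one abs_sin_x_le_abs_x[of "u * y / 2"] by (metis abs_le_square_iff)
    also have "2 * (u * y / 2)\<^sup>2 = u\<^sup>2 * y\<^sup>2 / 2" by (simp add: power2_eq_square)
    also have "\<dots> \<le> z"
    proof -
      have "u\<^sup>2 \<le> d\<^sup>2" using assms by (metis abs_ge_zero power2_abs power_mono)
      then show ?thesis by (simp add: z_def power_mult_distrib mult_right_mono)
    qed
    finally have "1 - cos (u * y) \<le> z" by simp
    moreover have "1 - cos (u * y) \<le> 2" using cos_ge_minus_one[of "u * y"] by linarith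
    moreover have "1 - exp (- z) \<ge> z / (1 + z)"
    proof -
      have "exp (- z) \<le> 1 / (1 + z)"
        using exp_ge_add_one_self[of z] z by (simp add: exp_minus divide_simps)
      then show ?thesis using z by (simp add: field_simps)
    qed
    moreover have "exp (- z) \<le> 1" using z by simp
    moreover have "z / (1 + z) \<ge> z / 2 \<or> z / (1 + z) \<ge> 1 / 2 \<and> z \<ge> 1"
      using z mult_left_le[of z z] by (auto simp: field_simps)
    ultimately have "1 - cos (u * y) \<le> 4 * (1 - exp (- z))" by argo
    then show "1 - cos (u * y) \<le> 4 * (1 - exp (- ((d * y)\<^sup>2 / 2)))" unfolding z_def .
  next
    show "integrable M (\<lambda>y. 4 * (1 - exp (- ((d * y)\<^sup>2 / 2))))"
      by (rule integrable_mult_right) (rule integrable_one_minus_gauss)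
  qed (rule integrable_one_minus_cos)
  then show ?thesis unfolding gauss_gap_def by (simp only: integral_mult_right_zero)
qed

text \<open>\<open>1 - cos\<close> is twice the squared sine of the half angle, and
  \<open>\<bar>sin (m * x)\<bar> \<le> m * \<bar>sin x\<bar>\<close> by induction. A bound near 0
  thereby extends to quadratic growth.\<close>

lemma cos_gap_mult_le: "cos_gap M (real m * t) \<le> (real m)\<^sup>2 * cos_gap M t"
proof -
  have sin: "\<bar>sin (real m * x)\<bar> \<le> real m * \<bar>sin x\<bar>" for x
  proof (induction m)
    case (Suc m)
    have "\<bar>sin (real (Suc m) * x)\<bar> = \<bar>sin (real m * x) * cos x + cos (real m * x) * sin x\<bar>"
      by (simp add: algebra_simps sin_add)
    also have "\<dots> \<le> \<bar>sin (real m * x)\<bar> * \<bar>cos x\<bar> + \<bar>cos (real m * x)\<bar> * \<bar>sin x\<bar>"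
      by (simp add: abs_mult[symmetric])
    also have "\<dots> \<le> \<bar>sin (real m * x)\<bar> * 1 + 1 * \<bar>sin x\<bar>"
      by (intro add_mono mult_mono) auto
    finally show ?case using Suc by (simp add: algebra_simps)
  qed simp
  have "cos_gap M (real m * t) \<le> (LINT y|M. (real m)\<^sup>2 * (1 - cos (t * y)))"
    unfolding cos_gap_def
  proof (rule integral_mono)
    fix y
    have "(sin (real m * (t * y / 2)))\<^sup>2 \<le> (real m * \<bar>sin (t * y / 2)\<bar>)\<^sup>2"
      using power_mono[OF sin[of "t * y / 2"] abs_ge_zero, of 2] by simp
    then have "2 * (sin (real m * t * y / 2))\<^sup>2 \<le> (real m)\<^sup>2 * (2 * (sin (t * y / 2))\<^sup>2)"
      by (simp add: power_mult_distrib mult.assoc)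
    then show "1 - cos (real m * t * y) \<le> (real m)\<^sup>2 * (1 - cos (t * y))"
      using cos_double_sin[of "t * y / 2"] cos_double_sin[of "real m * t * y / 2"] by simp
  next
    show "integrable M (\<lambda>y. (real m)\<^sup>2 * (1 - cos (t * y)))"
      by (rule integrable_mult_right) (rule integrable_one_minus_cos)
  qed (rule integrable_one_minus_cos)
  then show ?thesis unfolding cos_gap_def by (simp only: integral_mult_right_zero)
qed

text \<open>With \<open>v = s * \<bar>y\<bar>\<close>: for \<open>v \<le> 2\<close> the exponent
  \<open>v^2 / 2\<close> is at most \<open>v\<close>; for \<open>v > 2\<close> the right-hand
  integrand is already at least 1.\<close>

lemma gauss_gap_le_abs_laplace_gap:
  assumes "0 \<le> s"
  shows "gauss_gap M s \<le> 2 * abs_laplace_gap M s"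
proof -
  have "gauss_gap M s \<le> (LINT y|M. 2 * (1 - exp (- (s * \<bar>y\<bar>))))"
    unfolding gauss_gap_def
  proof (rule integral_mono)
    fix y
    define v where "v = s * \<bar>y\<bar>"
    have v: "0 \<le> v" using assms by (simp add: v_def)
    have e: "(s * y)\<^sup>2 / 2 = v * v / 2" by (simp add: v_def power2_eq_square abs_mult_self_eq algebra_simps)
    show "1 - exp (- ((s * y)\<^sup>2 / 2)) \<le> 2 * (1 - exp (- (s * \<bar>y\<bar>)))"
    proof (cases "v \<le> 2")
      case True
      then have "v * v \<le> 2 * v" using v by (intro mult_right_mono) auto
      then have "exp (- v) \<le> exp (- (v * v / 2))" by simp
      moreover have "exp (- v) \<le> 1" using v by simp
      ultimately have "1 - exp (- (v * v / 2)) \<le> 2 * (1 - exp (- v))" by argo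
      then show ?thesis unfolding e v_def .
    next
      case False
      have "2 \<le> exp (v)" using exp_ge_add_one_self[of v] False by linarith
      then have "exp (- v) \<le> 1 / 2" by (simp add: exp_minus field_simps)
      then have "1 - exp (- (v * v / 2)) \<le> 2 * (1 - exp (- v))"
        using exp_gt_zero[of "- (v * v / 2)"] by argo
      then show ?thesis unfolding e v_def .
    qed
  next
    show "integrable M (\<lambda>y. 2 * (1 - exp (- (s * \<bar>y\<bar>))))"
      by (rule integrable_mult_right) (rule integrable_one_minus_exp_abs[OF assms])
  qed (rule integrable_one_minus_gauss)
  then show ?thesis unfolding abs_laplace_gap_def by (simp only: integral_mult_right_zero)
qed

lemma gauss_gap_eq_0_imp_AE:
  assumes "gauss_gap M s = 0" "s \<noteq> 0"
  shows "AE y in M. y = 0"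
proof -
  have "AE y in M. 1 - exp (- ((s * y)\<^sup>2 / 2)) = 0"
    using assms(1) integrable_one_minus_gauss[of s] unfolding gauss_gap_def
    by (subst (asm) integral_nonneg_eq_0_iff_AE) auto
  then show ?thesis using assms(2) by (auto elim!: eventually_mono)
qed

end

section \<open>Differences of two independent copies\<close>

definition symmetrization :: "real measure \<Rightarrow> real measure" where
  "symmetrization M = distr (M \<Otimes>\<^sub>M M) borel (\<lambda>(x, y). x - y)"

context real_distribution
begin

lemma real_distribution_symmetrization: "real_distribution (symmetrization M)"
proof -
  interpret P: pair_prob_space M M ..
  show ?thesis unfolding symmetrization_def by (rule P.real_distribution_distr) simp
qed

lemma integral_symmetrization:
  fixes f :: "real \<Rightarrow> real"
  assumes [measurable]: "f \<in> borel_measurable borel" and C: "\<And>z. \<bar>f z\<bar> \<le> C"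
  shows "(LINT z|symmetrization M. f z) = (LINT x|M. LINT y|M. f (x - y))"
proof -
  interpret P: pair_prob_space M M ..
  have "integrable (M \<Otimes>\<^sub>M M) (\<lambda>p. f (fst p - snd p))"
    by (rule P.integrable_const_bound[where B = C]) (use C in auto)
  from P.integral_fst'[OF this] show ?thesis
    unfolding symmetrization_def by (subst integral_distr) (auto simp: case_prod_beta)
qed

text \<open>Integrating the addition formula for \<open>cos (t * x - t * y)\<close> gives the
  squares of the real and imaginary parts of the characteristic function. Only its modulus survives,
  so centering constants will drop out.\<close>

lemma cos_gap_symmetrization: "cos_gap (symmetrization M) t = 1 - (cmod (char M t))\<^sup>2"
proof -
  define c s where "c = (LINT x|M. cos (t * x))" and "s = (LINT x|M. sin (t * x))"
  have ic: "integrable M (\<lambda>x. cos (t * x))" by (rule integrable_const_bound[where B = 1]) auto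
  have sn: "integrable M (\<lambda>x. sin (t * x))" by (rule integrable_const_bound[where B = 1]) auto
  have ii: "integrable M (\<lambda>x. iexp (t * x))" by (rule integrable_iexp) auto
  have "Re (char M t) = c" unfolding char_def c_def
    by (subst integral_Re[OF ii, symmetric]) (simp add: Re_exp)
  moreover have "Im (char M t) = s" unfolding char_def s_def
    by (subst integral_Im[OF ii, symmetric]) (simp add: Im_exp)
  ultimately have ch: "(cmod (char M t))\<^sup>2 = c\<^sup>2 + s\<^sup>2" by (simp add: cmod_power2)
  have inner: "(LINT y|M. 1 - cos (t * (x - y))) = 1 - (cos (t * x) * c + sin (t * x) * s)" for x
  proof -
    have "(LINT y|M. 1 - cos (t * (x - y))) = (LINT y|M. 1 - (cos (t * x) * cos (t * y) + sin (t * x) * sin (t * y)))"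
      by (simp add: right_diff_distrib cos_diff)
    then show ?thesis using ic sn by (simp add: c_def s_def prob_space del: space_eq_univ)
  qed
  have "cos_gap (symmetrization M) t = (LINT x|M. LINT y|M. 1 - cos (t * (x - y)))"
    unfolding cos_gap_def
  proof (rule integral_symmetrization[where C = 2])
    show "\<bar>1 - cos (t * z)\<bar> \<le> 2" for z
      using cos_ge_minus_one[of "t * z"] cos_le_one[of "t * z"] by linarith
  qed simp
  also have "\<dots> = 1 - (c\<^sup>2 + s\<^sup>2)"
    unfolding inner using ic sn
    by (simp add: c_def s_def prob_space power2_eq_square del: space_eq_univ)
  finally show ?thesis using ch by simp
qed

end

context distribution_ge_1
begin

lemma abs_laplace_gap_symmetrization:
  assumes "0 \<le> s"
  shows "abs_laplace_gap (symmetrization M) s = (LINT x|M. LINT y|M. 1 - exp (- (s * \<bar>x - y\<bar>)))"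
  unfolding abs_laplace_gap_def
  by (rule integral_symmetrization[where C = 1]) (use assms in auto)

lemma integrable_one_minus_exp_abs_diff: "0 \<le> s \<Longrightarrow> integrable M (\<lambda>y. 1 - exp (- (s * \<bar>x - y\<bar>)))"
  by (rule integrable_const_bound[where B = 1]) auto

lemma integrable_integral_one_minus_exp_abs_diff:
  assumes "0 \<le> s"
  shows "integrable M (\<lambda>x. LINT y|M. 1 - exp (- (s * \<bar>x - y\<bar>)))"
proof (rule integrable_const_bound[where B = 1])
  have "0 \<le> (LINT y|M. 1 - exp (- (s * \<bar>x - y\<bar>)))" for x
    using assms by (intro Bochner_Integration.integral_nonneg) auto
  moreover have "(LINT y|M. 1 - exp (- (s * \<bar>x - y\<bar>))) \<le> (LINT y|M. 1)" for x
    using assms by (intro integral_mono integrable_one_minus_exp_abs_diff) auto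
  ultimately show "AE x in M. norm (LINT y|M. 1 - exp (- (s * \<bar>x - y\<bar>))) \<le> 1"
    using prob_space by simp
qed measurable

text \<open>\<open>\<bar>x - y\<bar> \<le> x + y\<close> for nonnegative \<open>x\<close>,
  \<open>y\<close>, and \<open>1 - p * q \<le> (1 - p) + (1 - q)\<close> for \<open>p\<close>,
  \<open>q\<close> in [0, 1].\<close>

lemma abs_laplace_gap_le:
  assumes s: "0 \<le> s"
  shows "abs_laplace_gap (symmetrization M) s \<le> 2 * laplace_gap M s"
proof -
  have i: "integrable M (\<lambda>x. 1 - exp (- (s * x)))" by (rule integrable_one_minus_exp[OF s])
  have "(LINT x|M. LINT y|M. 1 - exp (- (s * \<bar>x - y\<bar>))) \<le> (LINT x|M. (1 - exp (- (s * x))) + laplace_gap M s)"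
  proof (rule integral_mono_AE)
    show "AE x in M. (LINT y|M. 1 - exp (- (s * \<bar>x - y\<bar>))) \<le> (1 - exp (- (s * x))) + laplace_gap M s"
      using nonneg
    proof eventually_elim
      case (elim x)
      have "(LINT y|M. 1 - exp (- (s * \<bar>x - y\<bar>))) \<le> (LINT y|M. (1 - exp (- (s * x))) + (1 - exp (- (s * y))))"
      proof (rule integral_mono_AE)
        show "AE y in M. 1 - exp (- (s * \<bar>x - y\<bar>)) \<le> (1 - exp (- (s * x))) + (1 - exp (- (s * y)))"
          using nonneg
        proof eventually_elim
          case (elim y)
          have "s * \<bar>x - y\<bar> \<le> s * (x + y)" using s elim \<open>0 \<le> x\<close> by (intro mult_left_mono) auto
          then have "exp (- (s * x)) * exp (- (s * y)) \<le> exp (- (s * \<bar>x - y\<bar>))"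
            by (simp add: mult_exp_exp algebra_simps)
          moreover have "0 \<le> (1 - exp (- (s * x))) * (1 - exp (- (s * y)))"
            using s elim \<open>0 \<le> x\<close> by simp
          ultimately show ?case by (simp add: algebra_simps)
        qed
      qed (rule integrable_one_minus_exp_abs_diff[OF s] Bochner_Integration.integrable_add integrable_const i)+
      also have "\<dots> = (1 - exp (- (s * x))) + laplace_gap M s"
        unfolding laplace_gap_def by (subst Bochner_Integration.integral_add) (use i prob_space in auto)
      finally show ?case .
    qed
  qed (use i integrable_integral_one_minus_exp_abs_diff[OF s] in \<open>auto intro: Bochner_Integration.integrable_add\<close>)
  also have "\<dots> = 2 * laplace_gap M s"
    unfolding laplace_gap_def by (subst Bochner_Integration.integral_add) (use i prob_space in auto)
  finally show ?thesis by (simp add: abs_laplace_gap_symmetrization[OF s])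
qed

text \<open>The difference between \<open>X + X'\<close> and \<open>\<bar>X - X'\<bar>\<close> is twice the minimum, which is at
  most \<open>2 * m\<close> unless \<open>X > m\<close>.\<close>

lemma abs_laplace_gap_ge:
  assumes s: "0 \<le> s" and m: "0 \<le> m"
  shows "2 * laplace_gap M s - (laplace_gap M s)\<^sup>2 - 2 * s * m - 2 * measure M {m<..} * laplace_gap M s
    \<le> abs_laplace_gap (symmetrization M) s"
proof -
  let ?h = "laplace_gap M"
  have i: "integrable M (\<lambda>x. 1 - exp (- (t * x)))" if "0 \<le> t" for t by (rule integrable_one_minus_exp[OF that])
  have ie: "integrable M (\<lambda>x. exp (- (s * x)))"
    using Bochner_Integration.integrable_diff[OF integrable_const[of 1] i[OF s]] by simp
  have he: "(LINT x|M. exp (- (s * x))) = 1 - ?h s"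
    unfolding laplace_gap_def using ie prob_space by simp
  have ind: "integrable M (\<lambda>x. indicator {m<..} x * c)" for c :: real
    by (rule integrable_const_bound[where B = "\<bar>c\<bar>"]) (auto simp: indicator_def)
  \<comment> \<open>The left side is the gap of the sum of two independent copies,
    \<open>1 - (1 - ?h s)^2\<close>.\<close>
  have *: "(LINT x|M. 1 - exp (- (s * x)) * (1 - ?h s))
      \<le> (LINT x|M. (LINT y|M. 1 - exp (- (s * \<bar>x - y\<bar>))) + 2 * s * m + indicator {m<..} x * ?h (2 * s))"
  proof (rule integral_mono_AE)
    show "AE x in M. 1 - exp (- (s * x)) * (1 - ?h s)
        \<le> (LINT y|M. 1 - exp (- (s * \<bar>x - y\<bar>))) + 2 * s * m + indicator {m<..} x * ?h (2 * s)"
      using nonneg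
    proof eventually_elim
      case (elim x)
      have "(LINT y|M. 1 - exp (- (s * x)) * exp (- (s * y)))
          \<le> (LINT y|M. (1 - exp (- (s * \<bar>x - y\<bar>))) + (2 * s * m + indicator {m<..} x * (1 - exp (- (2 * s * y)))))"
      proof (rule integral_mono_AE)
        show "AE y in M. 1 - exp (- (s * x)) * exp (- (s * y))
            \<le> (1 - exp (- (s * \<bar>x - y\<bar>))) + (2 * s * m + indicator {m<..} x * (1 - exp (- (2 * s * y))))"
          using nonneg
        proof eventually_elim
          case (elim y)
          define z where "z = min x y"
          have z: "0 \<le> z" "x + y = \<bar>x - y\<bar> + 2 * z" using elim \<open>0 \<le> x\<close> by (auto simp: z_def)
          have "exp (- (s * x)) * exp (- (s * y)) = exp (- (s * \<bar>x - y\<bar>)) * exp (- (2 * s * z))"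
          proof -
            have "s * x + s * y = s * \<bar>x - y\<bar> + 2 * s * z"
              using arg_cong[OF z(2), of "\<lambda>v. s * v"] by (simp add: algebra_simps)
            then have "- (s * x) + - (s * y) = - (s * \<bar>x - y\<bar>) + - (2 * s * z)" by argo
            then show ?thesis by (simp only: mult_exp_exp)
          qed
          then have "exp (- (s * \<bar>x - y\<bar>)) - exp (- (s * x)) * exp (- (s * y)) = exp (- (s * \<bar>x - y\<bar>)) * (1 - exp (- (2 * s * z)))"
            by (simp add: algebra_simps)
          also have "\<dots> \<le> 1 * (1 - exp (- (2 * s * z)))"
            using s z by (intro mult_right_mono) auto
          \<comment> \<open>For \<open>x > m\<close> use \<open>z \<le> y\<close>: the indicator
            depends on \<open>x\<close> only, so integration gives the product of the tail and
            \<open>?h (2 * s)\<close>. Otherwise \<open>z \<le> m\<close>.\<close>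
          also have "\<dots> \<le> 2 * s * m + indicator {m<..} x * (1 - exp (- (2 * s * y)))"
          proof (cases "m < x")
            case True
            have "s * z \<le> s * y" using s by (intro mult_left_mono) (auto simp: z_def)
            then have "1 - exp (- (2 * s * z)) \<le> 1 - exp (- (2 * s * y))" by simp
            moreover have "0 \<le> 2 * s * m" using s m by simp
            ultimately have "1 - exp (- (2 * s * z)) \<le> 2 * s * m + (1 - exp (- (2 * s * y)))" by linarith
            then show ?thesis using True by simp
          next
            case False
            have "s * z \<le> s * m" using s False by (intro mult_left_mono) (auto simp: z_def)
            moreover have "1 - exp (- (2 * s * z)) \<le> 2 * s * z"
              using exp_ge_add_one_self[of "- (2 * s * z)"] by simp
            ultimately show ?thesis using False by simp
          qed
          finally show ?case by simp
        qed
        show "integrable M (\<lambda>y. 1 - exp (- (s * x)) * exp (- (s * y)))" using ie by auto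
        show "integrable M (\<lambda>y. (1 - exp (- (s * \<bar>x - y\<bar>))) + (2 * s * m + indicator {m<..} x * (1 - exp (- (2 * s * y)))))"
          by (intro Bochner_Integration.integrable_add integrable_one_minus_exp_abs_diff integrable_const integrable_mult_right i)
             (use s in auto)
      qed
      also have "(LINT y|M. 1 - exp (- (s * x)) * exp (- (s * y))) = 1 - exp (- (s * x)) * (1 - ?h s)"
        using ie he prob_space by simp
      also have "(LINT y|M. (1 - exp (- (s * \<bar>x - y\<bar>))) + (2 * s * m + indicator {m<..} x * (1 - exp (- (2 * s * y)))))
          = (LINT y|M. 1 - exp (- (s * \<bar>x - y\<bar>))) + (2 * s * m + indicator {m<..} x * ?h (2 * s))"
      proof -
        have i2: "integrable M (\<lambda>y. indicator {m<..} x * (1 - exp (- (2 * s * y))))"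
          by (rule integrable_mult_right) (rule i, use s in simp)
        have i3: "integrable M (\<lambda>y. 2 * s * m + indicator {m<..} x * (1 - exp (- (2 * s * y))))"
          by (intro Bochner_Integration.integrable_add i2 integrable_const)
        show ?thesis
          unfolding Bochner_Integration.integral_add[OF integrable_one_minus_exp_abs_diff[OF s] i3]
            Bochner_Integration.integral_add[OF integrable_const i2] integral_mult_right_zero laplace_gap_def
          using prob_space by simp
      qed
      finally show ?case by simp
    qed
    show "integrable M (\<lambda>x. (LINT y|M. 1 - exp (- (s * \<bar>x - y\<bar>))) + 2 * s * m + indicator {m<..} x * ?h (2 * s))"
      by (intro Bochner_Integration.integrable_add integrable_integral_one_minus_exp_abs_diff integrable_const ind s)
    show "integrable M (\<lambda>x. 1 - exp (- (s * x)) * (1 - ?h s))" using ie by auto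
  qed
  have l: "(LINT x|M. 1 - exp (- (s * x)) * (1 - ?h s)) = 1 - (1 - ?h s) * (1 - ?h s)"
    using ie he prob_space by simp
  have r: "(LINT x|M. (LINT y|M. 1 - exp (- (s * \<bar>x - y\<bar>))) + 2 * s * m + indicator {m<..} x * ?h (2 * s))
      = abs_laplace_gap (symmetrization M) s + 2 * s * m + measure M {m<..} * ?h (2 * s)"
  proof -
    note ii = integrable_integral_one_minus_exp_abs_diff[OF s]
    show ?thesis
      unfolding Bochner_Integration.integral_add[OF Bochner_Integration.integrable_add[OF ii integrable_const] ind]
        Bochner_Integration.integral_add[OF ii integrable_const] abs_laplace_gap_symmetrization[OF s]
      using prob_space by simp
  qed
  have "measure M {m<..} * ?h (2 * s) \<le> measure M {m<..} * (2 * ?h s)"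
    using laplace_gap_double_le[OF s] by (intro mult_left_mono) auto
  then show ?thesis using * unfolding l r by (simp add: power2_eq_square algebra_simps)
qed

lemma tail_tendsto_0: "((\<lambda>m. measure M {m<..}) \<longlongrightarrow> 0) at_top"
proof -
  have "measure M {m<..} = 1 - cdf M m" for m
  proof -
    have "{m<..} = space M - {..m}" by auto
    then show ?thesis using prob_compl[of "{..m}"] by (simp add: cdf_def)
  qed
  then show ?thesis using tendsto_diff[OF tendsto_const cdf_lim_at_top_prob, of 1] by simp
qed

text \<open>The upper bound is \<open>abs_laplace_gap_le\<close>. For the lower one divide
  \<open>abs_laplace_gap_ge\<close> by the gap: first fix \<open>m\<close> with a small tail, then
  let \<open>s\<close> tend to 0, where the gap itself and \<open>s\<close> divided by the gap
  vanish.\<close>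

lemma abs_laplace_gap_ratio:
  assumes lim: "filterlim (\<lambda>s. laplace_gap M s / s) at_top (at_right 0)"
  shows "((\<lambda>s. abs_laplace_gap (symmetrization M) s / laplace_gap M s) \<longlongrightarrow> 2) (at_right 0)"
proof (rule order_tendstoI)
  let ?h = "laplace_gap M" and ?H = "abs_laplace_gap (symmetrization M)"
  fix a :: real assume a: "a < 2"
  have "eventually (\<lambda>m. measure M {m<..} < (2 - a) / 2) at_top"
    using tail_tendsto_0 by (rule order_tendstoD) (use a in simp)
  with eventually_ge_at_top[of 0] have "eventually (\<lambda>m. 0 \<le> m \<and> measure M {m<..} < (2 - a) / 2) at_top"
    by eventually_elim simp
  then obtain m where m: "0 \<le> m" "measure M {m<..} < (2 - a) / 2"
    by (auto dest: eventually_happens'[OF trivial_limit_at_top_linorder])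
  have "((\<lambda>s. inverse (?h s / s)) \<longlongrightarrow> 0) (at_right 0)"
    by (rule filterlim_compose[OF tendsto_inverse_0_at_top[OF filterlim_ident] lim])
  then have "((\<lambda>s. 2 - ?h s - 2 * m * inverse (?h s / s) - 2 * measure M {m<..})
      \<longlongrightarrow> 2 - 0 - 2 * m * 0 - 2 * measure M {m<..}) (at_right 0)"
    by (intro tendsto_intros laplace_gap_tendsto_0)
  then have "eventually (\<lambda>s. a < 2 - ?h s - 2 * m * inverse (?h s / s) - 2 * measure M {m<..}) (at_right 0)"
    by (rule order_tendstoD) (use m in simp)
  with eventually_at_right_less[of 0]
  show "eventually (\<lambda>s. a < ?H s / ?h s) (at_right 0)"
  proof eventually_elim
    case (elim s)
    have h: "0 < ?h s" using laplace_gap_pos elim by simp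
    have "2 - ?h s - 2 * m * inverse (?h s / s) - 2 * measure M {m<..}
        = (2 * ?h s - (?h s)\<^sup>2 - 2 * s * m - 2 * measure M {m<..} * ?h s) / ?h s"
      using h elim by (simp add: power2_eq_square field_simps)
    also have "\<dots> \<le> ?H s / ?h s"
      using abs_laplace_gap_ge[of s m] m elim h by (intro divide_right_mono) auto
    finally show ?case using elim by simp
  qed
next
  fix a :: real assume a: "2 < a"
  show "eventually (\<lambda>s. abs_laplace_gap (symmetrization M) s / laplace_gap M s < a) (at_right 0)"
    using eventually_at_right_less[of 0]
  proof eventually_elim
    case (elim s)
    have "abs_laplace_gap (symmetrization M) s / laplace_gap M s \<le> 2"
      using abs_laplace_gap_le[of s] laplace_gap_pos[of s] elim by (simp add: pos_divide_le_eq)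
    then show ?case using a by simp
  qed
qed

text \<open>A finite mean would make \<open>gauss_gap\<close> at most linear, impossible for index
  below 1. So the mean is infinite, \<open>abs_laplace_gap\<close> outgrows \<open>s\<close>, the
  half-normal mixture carries the index over to it, and the ratio 2 passes it on to
  \<open>laplace_gap\<close>.\<close>

lemma regvar_0_laplace_gap_symmetrization:
  assumes rv: "regvar_0 \<alpha> (gauss_gap (symmetrization M))" and "\<alpha> < 1"
  shows "regvar_0 \<alpha> (laplace_gap M)"
proof -
  interpret N: real_distribution "symmetrization M" by (rule real_distribution_symmetrization)
  let ?h = "laplace_gap M" and ?H = "abs_laplace_gap (symmetrization M)" and ?G = "gauss_gap (symmetrization M)"
  have "\<not> integrable M (\<lambda>x. x)"
  proof
    assume int: "integrable M (\<lambda>x. x)"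
    have "\<forall>s>0. ?G s \<le> (4 * (LINT x|M. x)) * s"
    proof (intro allI impI)
      fix s :: real assume s: "0 < s"
      have "?G s \<le> 2 * ?H s" using s by (intro N.gauss_gap_le_abs_laplace_gap) simp
      also have "\<dots> \<le> 2 * (2 * ?h s)" using s abs_laplace_gap_le[of s] by simp
      also have "\<dots> \<le> 2 * (2 * ((LINT x|M. x) * s))" using s laplace_gap_le_mean[OF int, of s] by simp
      finally show "?G s \<le> (4 * (LINT x|M. x)) * s" by simp
    qed
    with regvar_0_unbounded_quotient[OF rv \<open>\<alpha> < 1\<close>, of "4 * (LINT x|M. x)"] N.gauss_gap_nonneg
    show False by blast
  qed
  then have hlim: "filterlim (\<lambda>s. ?h s / s) at_top (at_right 0)"
    by (rule laplace_gap_quotient_infinite_mean)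
  note ratio = abs_laplace_gap_ratio[OF hlim]
  have "filterlim (\<lambda>s. (?H s / ?h s) * (?h s / s)) at_top (at_right 0)"
    by (rule filterlim_tendsto_pos_mult_at_top[OF ratio _ hlim]) simp
  moreover have "eventually (\<lambda>s. (?H s / ?h s) * (?h s / s) = ?H s / s) (at_right 0)"
    using eventually_at_right_less[of 0]
  proof eventually_elim
    case (elim s)
    then show ?case using laplace_gap_pos[of s] by simp
  qed
  ultimately have Hlim: "filterlim (\<lambda>s. ?H s / s) at_top (at_right 0)"
    by (rule filterlim_cong[OF refl refl, THEN iffD1, rotated])
  have "regvar_0 \<alpha> ?H"
    by (rule regvar_0_mixture[OF rv N.gauss_gap_measurable N.gauss_gap_nonneg N.gauss_gap_le_1
          integrable_half_normal_density half_normal_density_bounds _ N.abs_laplace_gap_eq_mixture Hlim])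
       (auto simp: half_normal_density_def)
  moreover have "((\<lambda>s. ?h s / ?H s) \<longlongrightarrow> inverse 2) (at_right 0)"
    using tendsto_inverse[OF ratio] by simp
  ultimately show ?thesis by (rule regvar_0_cong_ratio) simp
qed

section \<open>Regularly varying tails\<close>

lemma regvar_0_tail:
  assumes L: "slowly_varying L" and tail: "\<And>x. 1 \<le> x \<Longrightarrow> measure M {x<..} = x powr (- \<alpha>) * L x"
  shows "regvar_0 \<alpha> (\<lambda>v. measure M {1 / v<..})"
  unfolding regvar_0_def
proof (intro allI impI)
  fix c :: real assume c: "0 < c"
  have "((\<lambda>x. L (1 / c * x) / L x) \<longlongrightarrow> 1) at_top"
    using L c unfolding slowly_varying_def by (meson zero_less_divide_1_iff)
  then have "((\<lambda>s. L (1 / c * inverse s) / L (inverse s)) \<longlongrightarrow> 1) (at_right 0)"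
    by (rule filterlim_compose[OF _ filterlim_inverse_at_top_right])
  then have "((\<lambda>s. c powr \<alpha> * (L (1 / c * inverse s) / L (inverse s))) \<longlongrightarrow> c powr \<alpha> * 1) (at_right 0)"
    by (intro tendsto_mult tendsto_const)
  moreover have "eventually (\<lambda>s. c powr \<alpha> * (L (1 / c * inverse s) / L (inverse s))
      = measure M {1 / (c * s)<..} / measure M {1 / s<..}) (at_right 0)"
  proof -
    \<comment> \<open>The tail formula asks for \<open>1 / s\<close> and \<open>1 / (c * s)\<close>
      to be at least 1.\<close>
    have "eventually (\<lambda>s. 0 < s \<and> s < min 1 (1 / c)) (at_right 0)"
      unfolding eventually_at_right_field by (intro exI[of _ "min 1 (1 / c)"]) (use c in auto)
    then show ?thesis
    proof eventually_elim
      case (elim s)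
      have ge: "1 \<le> 1 / s" "1 \<le> 1 / (c * s)" using elim c by (auto simp: field_simps)
      have "(1 / (c * s)) powr (- \<alpha>) = c powr \<alpha> * (1 / s) powr (- \<alpha>)"
        using elim c by (simp add: powr_divide powr_minus powr_mult)
      then show ?case using elim c unfolding tail[OF ge(1)] tail[OF ge(2)]
        by (simp add: inverse_eq_divide)
    qed
  qed
  ultimately show "((\<lambda>s. measure M {1 / (c * s)<..} / measure M {1 / s<..}) \<longlongrightarrow> c powr \<alpha>) (at_right 0)"
    by (simp add: Lim_transform_eventually)
qed

text \<open>With infinite mean this is the exponential mixture of the tail function. With finite
  mean, Markov's inequality makes the tail function at most linear, which forces
  \<open>\<alpha> = 1\<close>, the index of the finite mean case.\<close>

lemma regvar_0_laplace_gap_tail: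
  assumes L: "slowly_varying L" and tail: "\<And>x. 1 \<le> x \<Longrightarrow> measure M {x<..} = x powr (- \<alpha>) * L x"
    and "\<alpha> \<le> 1"
  shows "regvar_0 \<alpha> (laplace_gap M)"
proof (cases "integrable M (\<lambda>x. x)")
  case int: True
  have "\<alpha> = 1"
  proof (rule ccontr)
    assume "\<alpha> \<noteq> 1"
    then have "\<alpha> < 1" using \<open>\<alpha> \<le> 1\<close> by simp
    have "\<forall>s>0. measure M {1 / s<..} \<le> (LINT x|M. x) * s"
    proof (intro allI impI)
      fix s :: real assume s: "0 < s"
      have "measure M {1 / s<..} = (LINT x|M. indicator {1 / s<..} x)" by simp
      also have "\<dots> \<le> (LINT x|M. x * s)"
      proof (rule integral_mono_AE)
        show "AE x in M. indicator {1 / s<..} x \<le> x * s"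
          using nonneg by eventually_elim (use s in \<open>auto simp: indicator_def field_simps\<close>)
        show "integrable M (indicator {1 / s<..} :: real \<Rightarrow> real)"
          by (rule integrable_real_indicator) (auto simp: emeasure_eq_measure)
      qed (use int in auto)
      finally show "measure M {1 / s<..} \<le> (LINT x|M. x) * s" by simp
    qed
    with regvar_0_unbounded_quotient[OF regvar_0_tail[OF L tail] \<open>\<alpha> < 1\<close>, of "LINT x|M. x"]
    show False by simp
  qed
  with regvar_0_laplace_gap_finite_mean[OF int] show ?thesis by simp
next
  case False
  let ?f = "\<lambda>v. measure M {1 / v<..}" and ?p = "\<lambda>u::real. indicator {0<..} u * exp (- u) :: real"
  have meas: "?f \<in> borel_measurable borel"
  proof -
    have "?f v = (LINT x|M. (if 1 / v < x then 1 else 0))" for v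
    proof -
      have "(LINT x|M. (if 1 / v < x then 1 else 0)) = (LINT x|M. indicator {1 / v<..} x :: real)"
        by (rule Bochner_Integration.integral_cong) (auto simp: indicator_def)
      then show ?thesis by simp
    qed
    then show ?thesis by simp
  qed
  show ?thesis
    by (rule regvar_0_mixture[where p = ?p and B = 1, OF regvar_0_tail[OF L tail] meas _ _ integrable_exp_minus_half_line _ _ _
          laplace_gap_eq_tail_mixture laplace_gap_quotient_infinite_mean[OF False]])
       (auto simp: indicator_def)
qed

end

subsection \<open>Domains of attraction\<close>

lemma real_distribution_iid_sum_law:
  assumes "real_distribution M"
  shows "real_distribution (iid_sum_law M n)"
proof -
  interpret M: real_distribution M by fact
  interpret P: prob_space "Pi\<^sub>M {..<n} (\<lambda>_. M)" by (rule prob_space_PiM) (rule M.prob_space_axioms)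
  have "(\<lambda>\<omega>. \<omega> i) \<in> borel_measurable (Pi\<^sub>M {..<n} (\<lambda>_. M))" if "i < n" for i
    using measurable_component_singleton[of i "{..<n}" "\<lambda>_. M"] that
    by (simp cong: measurable_cong_sets)
  then show ?thesis unfolding iid_sum_law_def by (intro P.real_distribution_distr borel_measurable_sum) auto
qed

lemma char_iid_sum_law:
  assumes "real_distribution M"
  shows "char (iid_sum_law M n) t = char M t ^ n"
proof -
  interpret M: real_distribution M by fact
  interpret P: product_sigma_finite "\<lambda>_::nat. M" by unfold_locales
  have [measurable]: "(\<lambda>\<omega>. \<omega> i) \<in> borel_measurable (Pi\<^sub>M {..<n} (\<lambda>_. M))" if "i < n" for i
    using measurable_component_singleton[of i "{..<n}" "\<lambda>_. M"] that
    by (simp cong: measurable_cong_sets)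
  have "(\<lambda>\<omega>. \<Sum>i<n. \<omega> i) \<in> borel_measurable (Pi\<^sub>M {..<n} (\<lambda>_. M))"
    by (intro borel_measurable_sum) auto
  then have "char (iid_sum_law M n) t = (CLINT \<omega>|Pi\<^sub>M {..<n} (\<lambda>_. M). iexp (t * (\<Sum>i<n. \<omega> i)))"
    unfolding char_def iid_sum_law_def by (subst integral_distr) auto
  also have "\<dots> = (CLINT \<omega>|Pi\<^sub>M {..<n} (\<lambda>_. M). \<Prod>i<n. iexp (t * \<omega> i))"
    by (simp add: sum_distrib_left exp_sum)
  also have "\<dots> = (\<Prod>i<n. CLINT x|M. iexp (t * x))"
    by (rule P.product_integral_prod) (auto intro!: M.integrable_iexp)
  finally show ?thesis by (simp add: char_def)
qed

lemma cmod_char_distr_affine: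
  assumes "real_distribution M"
  shows "cmod (char (distr M borel (\<lambda>x. c * x + d)) t) = cmod (char M (c * t))"
proof -
  interpret real_distribution M by fact
  have "char (distr M borel (\<lambda>x. c * x + d)) t = (CLINT x|M. iexp (t * (c * x + d)))"
    unfolding char_def by (subst integral_distr) auto
  also have "\<dots> = (CLINT x|M. iexp (t * d) * iexp (c * t * x))"
    by (simp add: mult_exp_exp algebra_simps)
  also have "\<dots> = iexp (t * d) * char M (c * t)"
    unfolding char_def by (rule integral_mult_right_zero)
  finally show ?thesis by (simp add: norm_mult del: of_real_mult)
qed

text \<open>With \<open>T n = - n * ln (1 - x n)\<close>, which tends to \<open>- ln r\<close>, the
  elementary bounds for \<open>ln\<close> give
  \<open>(1 - x n) * T n \<le> n * x n \<le> T n\<close>; the upper one also shows that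
  \<open>x\<close> tends to 0.\<close>

lemma tendsto_mult_of_power_tendsto:
  fixes x :: "nat \<Rightarrow> real"
  assumes x: "\<And>n. 0 \<le> x n" "\<And>n. x n \<le> 1" and lim: "(\<lambda>n. (1 - x n) ^ n) \<longlonglongrightarrow> r" and r: "0 < r"
  shows "(\<lambda>n. real n * x n) \<longlonglongrightarrow> - ln r"
proof -
  define T where "T = (\<lambda>n. - ln ((1 - x n) ^ n))"
  have T: "T \<longlonglongrightarrow> - ln r" unfolding T_def using lim r by (intro tendsto_intros) auto
  \<comment> \<open>\<open>0 < n\<close> is recorded because \<open>0 ^ 0 = 1\<close>: only for
    positive \<open>n\<close> does a positive power exclude \<open>1 - x n = 0\<close>.\<close>
  have ev: "eventually (\<lambda>n. (1 - x n) ^ n > 0 \<and> 0 < n) sequentially"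
    using order_tendstoD(1)[OF lim r] eventually_gt_at_top[of 0] by eventually_elim simp
  have bounds: "eventually (\<lambda>n. (1 - x n) * T n \<le> real n * x n \<and> real n * x n \<le> T n) sequentially"
    using ev
  proof eventually_elim
    case (elim n)
    have p: "0 < 1 - x n"
    proof (rule ccontr)
      assume "\<not> 0 < 1 - x n"
      then have "1 - x n = 0" using x(2)[of n] by simp
      then show False using elim by (auto simp: power_0_left split: if_splits)
    qed
    have Tn: "T n = real n * - ln (1 - x n)" using p by (simp add: T_def ln_realpow)
    have "ln (1 - x n) \<le> - x n" using ln_le_minus_one[OF p] by simp
    then have 1: "real n * x n \<le> T n" unfolding Tn by (intro mult_left_mono) auto
    have "- ln (1 - x n) = ln (1 / (1 - x n))" using p by (simp add: ln_div)
    also have "\<dots> \<le> 1 / (1 - x n) - 1" using p by (intro ln_le_minus_one) simp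
    also have "\<dots> = x n / (1 - x n)" using p by (simp add: field_simps)
    finally have "(1 - x n) * - ln (1 - x n) \<le> x n" using p by (simp add: field_simps)
    then have "real n * ((1 - x n) * - ln (1 - x n)) \<le> real n * x n" by (rule mult_left_mono) simp
    then have "(1 - x n) * T n \<le> real n * x n" unfolding Tn by (simp add: algebra_simps)
    with 1 show ?case by simp
  qed
  have "x \<longlonglongrightarrow> 0"
  proof (rule tendsto_sandwich)
    show "eventually (\<lambda>n. 0 \<le> x n) sequentially" using x by simp
    have "(\<lambda>n. T n * (1 / real n)) \<longlonglongrightarrow> - ln r * 0"
      by (intro tendsto_mult T lim_1_over_n)
    then show "(\<lambda>n. T n / real n) \<longlonglongrightarrow> 0" by simp
    show "eventually (\<lambda>n. x n \<le> T n / real n) sequentially"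
      using ev bounds by eventually_elim (simp add: field_simps)
  qed simp
  then have "(\<lambda>n. (1 - x n) * T n) \<longlonglongrightarrow> (1 - 0) * - ln r"
    by (intro tendsto_intros T)
  then have "(\<lambda>n. (1 - x n) * T n) \<longlonglongrightarrow> - ln r" by simp
  then show ?thesis
    by (rule tendsto_sandwich[OF _ _ _ T, rotated 2])
       (use bounds in \<open>auto elim: eventually_mono\<close>)
qed

text \<open>Placing \<open>n * x\<close> between consecutive integers shows that
  \<open>n * \<bar>V x - x * V 1\<bar>\<close> is at most \<open>V 1\<close> for all large
  \<open>n\<close>, so the difference vanishes.\<close>

lemma monotone_homogeneous_imp_linear:
  fixes V :: "real \<Rightarrow> real"
  assumes mono: "\<And>x y. 0 < x \<Longrightarrow> x \<le> y \<Longrightarrow> V x \<le> V y"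
    and hom: "\<And>n x. 1 \<le> n \<Longrightarrow> 0 < x \<Longrightarrow> V (real n * x) = real n * V x"
    and x: "0 < x"
  shows "V x = x * V 1"
proof -
  have V1: "0 \<le> V 1" using mono[of 1 "real 2 * 1"] hom[of 2 1] by simp
  have nat: "V (real m) = real m * V 1" if "1 \<le> m" for m using hom[OF that, of 1] by simp
  have bound: "real n * \<bar>V x - x * V 1\<bar> \<le> V 1" if n: "1 \<le> n" "1 \<le> real n * x" for n
  proof -
    define m where "m = nat \<lfloor>real n * x\<rfloor>"
    have m: "1 \<le> m" "real m \<le> real n * x" "real n * x \<le> real (Suc m)"
      using n unfolding m_def by (auto simp: le_nat_floor, linarith)
    have nV: "V (real n * x) = real n * V x" using hom n x by simp
    have "real m * V 1 \<le> real n * V x" "real n * V x \<le> real (Suc m) * V 1"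
      using mono[of "real m" "real n * x"] mono[of "real n * x" "real (Suc m)"] m n x nat[of m] nat[of "Suc m"] nV
      by auto
    moreover have "real m * V 1 \<le> (real n * x) * V 1" "(real n * x) * V 1 \<le> real (Suc m) * V 1"
      using m V1 by (auto intro: mult_right_mono simp del: of_nat_Suc)
    moreover have "real (Suc m) * V 1 = real m * V 1 + V 1" by (simp add: algebra_simps)
    ultimately have "\<bar>real n * V x - (real n * x) * V 1\<bar> \<le> V 1" by argo
    moreover have "real n * V x - (real n * x) * V 1 = real n * (V x - x * V 1)" by (simp add: algebra_simps)
    ultimately show ?thesis by (simp add: abs_mult)
  qed
  have "\<bar>V x - x * V 1\<bar> = 0"
  proof (rule ccontr)
    assume "\<bar>V x - x * V 1\<bar> \<noteq> 0"
    then have p: "0 < \<bar>V x - x * V 1\<bar>" by simp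
    obtain n :: nat where n: "max (1 / x) (max 1 (V 1 / \<bar>V x - x * V 1\<bar>)) < real n"
      using reals_Archimedean2 by blast
    then have "1 / x < real n" "1 < real n" "V 1 / \<bar>V x - x * V 1\<bar> < real n" by auto
    then have "1 \<le> real n * x" "1 \<le> n" "V 1 < real n * \<bar>V x - x * V 1\<bar>"
      using x p by (auto simp: field_simps)
    with bound[of n] show False by simp
  qed
  then show ?thesis by simp
qed

lemma (in real_distribution) cos_gap_symmetrization_bounds:
  "0 \<le> cos_gap (symmetrization M) t" "cos_gap (symmetrization M) t \<le> 1"
  using cmod_char_le_1[of t] by (auto simp: cos_gap_symmetrization power_le_one)

lemma (in real_distribution) gauss_gap_tendsto_0: "(gauss_gap M \<longlongrightarrow> 0) (at 0)"
proof -
  have "isCont (gauss_gap M) 0"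
    unfolding continuous_at_sequentially comp_def gauss_gap_def
  proof safe
    fix X :: "nat \<Rightarrow> real" assume X: "X \<longlonglongrightarrow> 0"
    show "(\<lambda>n. LINT y|M. 1 - exp (- ((X n * y)\<^sup>2 / 2))) \<longlonglongrightarrow> (LINT y|M. 1 - exp (- ((0 * y)\<^sup>2 / 2)))"
    proof (rule integral_dominated_convergence[where w = "\<lambda>_. 1"])
      have "(\<lambda>n. 1 - exp (- ((X n * y)\<^sup>2 / 2))) \<longlonglongrightarrow> 1 - exp (- ((0 * y)\<^sup>2 / 2))" for y
        by (intro tendsto_intros X) simp
      then show "AE y in M. (\<lambda>n. 1 - exp (- ((X n * y)\<^sup>2 / 2))) \<longlonglongrightarrow> 1 - exp (- ((0 * y)\<^sup>2 / 2))"
        by (rule AE_I2)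
    qed auto
  qed
  then show ?thesis by (simp add: isCont_def gauss_gap_def)
qed

lemma (in real_distribution) cos_gap_measurable [measurable]: "cos_gap M \<in> borel_measurable borel"
  unfolding cos_gap_def by measurable

text \<open>If the gap were 0, two independent copies would agree almost surely; then for almost
  every \<open>x\<close> all mass would sit at \<open>x\<close>.\<close>

lemma (in real_distribution) gauss_gap_symmetrization_pos:
  assumes nondeg: "\<forall>c. measure M {c} \<noteq> 1"
  shows "0 < gauss_gap (symmetrization M) 1"
proof -
  interpret N: real_distribution "symmetrization M" by (rule real_distribution_symmetrization)
  interpret P: pair_prob_space M M ..
  have "gauss_gap (symmetrization M) 1 \<noteq> 0"
  proof
    assume "gauss_gap (symmetrization M) 1 = 0"
    then have "AE z in symmetrization M. z = 0" by (rule N.gauss_gap_eq_0_imp_AE) simp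
    then have "AE p in M \<Otimes>\<^sub>M M. fst p - snd p = 0"
      unfolding symmetrization_def by (subst (asm) AE_distr_iff) (auto simp: case_prod_beta)
    then have "AE x in M. AE y in M. fst (x, y) - snd (x, y) = 0" by (rule P.AE_pair)
    then have "AE x in M. measure M {x} = 1"
    proof eventually_elim
      case (elim x)
      then have "AE y in M. y \<in> {x}" by eventually_elim simp
      then show ?case using prob_eq_1[of "{x}"] by simp
    qed
    with nondeg show False by (simp add: AE_False)
  qed
  then show ?thesis using N.gauss_gap_nonneg[of 1] by linarith
qed

text \<open>Taking moduli removes the centering \<open>\<gamma>\<close> from the convolution
  identity.\<close>

lemma stable_law_char_power:
  assumes D: "stable_law \<alpha> D" and n: "1 \<le> n"
  shows "cmod (char D (real n powr (1 / \<alpha>) * t)) = cmod (char D t) ^ n"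
proof -
  have rd: "real_distribution D" using D by (simp add: stable_law_def)
  obtain \<gamma> where \<gamma>: "iid_sum_law D n = distr D borel (\<lambda>x. real n powr (1 / \<alpha>) * x + \<gamma>)"
    using D n unfolding stable_law_def by blast
  have "cmod (char D (real n powr (1 / \<alpha>) * t)) = cmod (char (iid_sum_law D n) t)"
    unfolding \<gamma> by (rule cmod_char_distr_affine[OF rd, symmetric])
  then show ?thesis by (simp add: char_iid_sum_law[OF rd] norm_power)
qed

text \<open>A zero at \<open>t\<close> propagates to \<open>n powr (- (1 / \<alpha>)) * t\<close>,
  hence by continuity to 0, where the value is 1.\<close>

lemma stable_law_char_nonzero:
  assumes D: "stable_law \<alpha> D"
  shows "char D t \<noteq> 0"
proof
  assume zero: "char D t = 0"
  interpret real_distribution D using D by (simp add: stable_law_def)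
  have \<alpha>: "0 < \<alpha>" using D by (simp add: stable_law_def)
  have "char D (real n powr (- (1 / \<alpha>)) * t) = 0" if n: "1 \<le> n" for n
  proof -
    have e: "real n powr (1 / \<alpha>) * (real n powr (- (1 / \<alpha>)) * t) = t"
      using n by (simp add: mult.assoc[symmetric] powr_add[symmetric])
    then have "cmod (char D (real n powr (- (1 / \<alpha>)) * t)) ^ n = 0"
      using stable_law_char_power[OF D n, of "real n powr (- (1 / \<alpha>)) * t"] zero unfolding e by simp
    then show ?thesis by simp
  qed
  then have "eventually (\<lambda>n. char D (real n powr (- (1 / \<alpha>)) * t) = 0) sequentially"
    by (intro eventually_sequentiallyI[of 1]) simp
  then have "(\<lambda>n. char D (real n powr (- (1 / \<alpha>)) * t)) \<longlonglongrightarrow> 0"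
    by (rule tendsto_eventually)
  moreover have "(\<lambda>n. char D (real n powr (- (1 / \<alpha>)) * t)) \<longlonglongrightarrow> char D (0 * t)"
  proof (rule isCont_tendsto_compose[OF isCont_char])
    have "(\<lambda>n. real n powr (- (1 / \<alpha>))) \<longlonglongrightarrow> 0"
      by (rule tendsto_neg_powr) (use \<alpha> filterlim_real_sequentially in auto)
    then show "(\<lambda>n. real n powr (- (1 / \<alpha>)) * t) \<longlonglongrightarrow> 0 * t" by (intro tendsto_intros)
  qed
  ultimately have "char D (0 * t) = 0" by (rule LIMSEQ_unique[rotated])
  then show False using char_zero by simp
qed

text \<open>The limit \<open>\<Gamma> s\<close> of \<open>n * gauss_gap (s / a n)\<close> comes by
  dominated convergence from that of \<open>n * k (u / a n)\<close>. Stability and monotonicity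
  identify it as a multiple of \<open>s powr \<alpha>\<close>, and
  \<open>regvar_0_from_sequence\<close> concludes.\<close>

lemma regvar_0_gauss_gap_domain_of_attraction:
  assumes M: "real_distribution M" and D: "stable_law \<alpha> D" and dom: "in_domain_of_attraction M D"
  shows "regvar_0 \<alpha> (gauss_gap (symmetrization M))"
proof -
  interpret M: real_distribution M by fact
  interpret N: real_distribution "symmetrization M" by (rule M.real_distribution_symmetrization)
  have \<alpha>: "0 < \<alpha>" and rd: "real_distribution D" and nondeg: "\<forall>c. measure D {c} \<noteq> 1"
    using D by (auto simp: stable_law_def)
  interpret D: real_distribution D by fact
  interpret ND: real_distribution "symmetrization D" by (rule D.real_distribution_symmetrization)
  obtain a b where a: "\<And>n. 0 < a n"
    and conv: "weak_conv_m (\<lambda>n. distr (iid_sum_law M n) borel (\<lambda>x. (x - b n) / a n)) D"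
    using dom unfolding in_domain_of_attraction_def by blast
  let ?G = "gauss_gap (symmetrization M)" and ?\<phi> = std_normal_density
  define S where "S n = distr (iid_sum_law M n) borel (\<lambda>x. (x - b n) / a n)" for n
  define k where "k = cos_gap (symmetrization M)"
  define kD where "kD = cos_gap (symmetrization D)"
  define l where "l t = - ln (1 - kD t)" for t
  have S: "real_distribution (S n)" for n
  proof -
    interpret real_distribution "iid_sum_law M n" by (rule real_distribution_iid_sum_law[OF M])
    show ?thesis unfolding S_def by (rule real_distribution_distr) simp
  qed
  have k01: "0 \<le> k t" "k t \<le> 1" for t
    using M.cos_gap_symmetrization_bounds by (auto simp: k_def)
  have kD01: "0 \<le> kD t" "kD t \<le> 1" for t
    using D.cos_gap_symmetrization_bounds by (auto simp: kD_def)
  have kD_pos: "0 < 1 - kD t" for t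
    using stable_law_char_nonzero[OF D] by (simp add: kD_def D.cos_gap_symmetrization)
  \<comment> \<open>The modulus of the characteristic function does not see the shift
    \<open>b n\<close>, and the independent sum turns it into an \<open>n\<close>-th power.\<close>
  have kS: "cos_gap (symmetrization (S n)) t = 1 - (1 - k (t / a n)) ^ n" for n t
  proof -
    interpret S: real_distribution "S n" by (rule S)
    have "cmod (char (S n) t) = cmod (char (distr (iid_sum_law M n) borel (\<lambda>x. 1 / a n * x + - (b n / a n))) t)"
      by (simp add: S_def diff_divide_distrib)
    also have "\<dots> = cmod (char M (t / a n)) ^ n"
      by (subst cmod_char_distr_affine[OF real_distribution_iid_sum_law[OF M]])
         (simp add: char_iid_sum_law[OF M] norm_power)
    finally show ?thesis
      by (simp add: S.cos_gap_symmetrization k_def M.cos_gap_symmetrization power_mult[symmetric] mult.commute)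
  qed
  have Slim: "(\<lambda>n. cos_gap (symmetrization (S n)) t) \<longlonglongrightarrow> kD t" for t
  proof -
    have "(\<lambda>n. char (S n) t) \<longlonglongrightarrow> char D t"
      by (rule levy_continuity1[OF S rd]) (use conv in \<open>simp add: S_def[abs_def]\<close>)
    then have "(\<lambda>n. 1 - (cmod (char (S n) t))\<^sup>2) \<longlonglongrightarrow> 1 - (cmod (char D t))\<^sup>2"
      by (intro tendsto_intros)
    then show ?thesis
      by (simp add: real_distribution.cos_gap_symmetrization[OF S] D.cos_gap_symmetrization kD_def)
  qed
  have klim: "(\<lambda>n. real n * k (t / a n)) \<longlonglongrightarrow> l t" for t
    unfolding l_def
  proof (rule tendsto_mult_of_power_tendsto[OF k01 _ kD_pos])
    show "(\<lambda>n. (1 - k (t / a n)) ^ n) \<longlonglongrightarrow> 1 - kD t"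
      using tendsto_diff[OF tendsto_const Slim, of 1 t] by (simp add: kS)
  qed
  text \<open>Domination: \<open>gauss_gap\<close> of the normalized sums controls \<open>n k(u / a\<^sub>n)\<close> uniformly near \<open>u = 0\<close>,
    and \<open>k(m t) \<le> m\<^sup>2 k(t)\<close> extends this to quadratic growth in \<open>u\<close>.\<close>
  obtain d n0 where d: "0 < d"
    and small: "\<And>n u. n0 \<le> n \<Longrightarrow> \<bar>u\<bar> \<le> d \<Longrightarrow> real n * k (u / a n) \<le> 1"
  proof -
    \<comment> \<open>Through the factor 4 of \<open>cos_gap_le_gauss_gap\<close>, 1/16 keeps
      \<open>(1 - k (u / a n)) ^ n\<close> at 3/4 or above. This power is at most
      \<open>exp (- (n * k (u / a n)))\<close>, so \<open>exp (- 1) \<le> 1 / 2\<close> yields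
      \<open>n * k (u / a n) \<le> 1\<close>.\<close>
    have "eventually (\<lambda>d. gauss_gap (symmetrization D) d < 1 / 16) (at_right 0)"
      using ND.gauss_gap_tendsto_0 by (intro order_tendstoD(2)[of _ 0]) (auto intro: filterlim_mono at_le)
    from eventually_happens'[OF trivial_limit_at_right_real eventually_conj[OF this eventually_at_right_less]]
    obtain d where d: "0 < d" "gauss_gap (symmetrization D) d < 1 / 16" by auto
    have "(\<lambda>n. gauss_gap (symmetrization (S n)) d) \<longlonglongrightarrow> gauss_gap (symmetrization D) d"
    proof -
      interpret NS: real_distribution "symmetrization (S n)" for n
        by (rule real_distribution.real_distribution_symmetrization[OF S])
      show ?thesis
        unfolding NS.gauss_gap_eq_integral_cos_gap ND.gauss_gap_eq_integral_cos_gap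
      proof (rule integral_dominated_convergence[where w = ?\<phi>])
        show "AE u in lborel. (\<lambda>n. cos_gap (symmetrization (S n)) (d * u) * ?\<phi> u) \<longlonglongrightarrow> cos_gap (symmetrization D) (d * u) * ?\<phi> u"
          using Slim by (intro AE_I2 tendsto_intros) (simp add: kD_def)
        show "AE u in lborel. norm (cos_gap (symmetrization (S n)) (d * u) * ?\<phi> u) \<le> ?\<phi> u" for n
          using real_distribution.cos_gap_symmetrization_bounds[OF S]
          by (intro AE_I2) (simp add: abs_mult mult_left_le_one_le)
      qed auto
    qed
    then have "eventually (\<lambda>n. gauss_gap (symmetrization (S n)) d < 1 / 16) sequentially"
      using d(2) by (rule order_tendstoD)
    then obtain n0 where n0: "\<And>n. n0 \<le> n \<Longrightarrow> gauss_gap (symmetrization (S n)) d < 1 / 16"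
      by (auto simp: eventually_sequentially)
    have "real n * k (u / a n) \<le> 1" if "n0 \<le> n" "\<bar>u\<bar> \<le> d" for n u
    proof -
      interpret NS: real_distribution "symmetrization (S n)"
        by (rule real_distribution.real_distribution_symmetrization[OF S])
      have "1 - (1 - k (u / a n)) ^ n \<le> 4 * (1 / 16)"
        using NS.cos_gap_le_gauss_gap[OF that(2)] n0[OF that(1)] unfolding kS by linarith
      moreover have "(1 - k (u / a n)) ^ n \<le> exp (- k (u / a n)) ^ n"
        using k01 exp_ge_add_one_self[of "- k (u / a n)"] by (intro power_mono) auto
      moreover have "exp (- k (u / a n)) ^ n = exp (- (real n * k (u / a n)))"
        by (simp add: exp_of_nat_mult[symmetric])
      ultimately have "1 / 2 \<le> exp (- (real n * k (u / a n)))" by linarith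
      moreover have "exp (- 1) \<le> (1 / 2 :: real)"
        using exp_ge_add_one_self[of 1] by (simp add: exp_minus field_simps)
      ultimately have "exp (- 1) \<le> exp (- (real n * k (u / a n)))" by linarith
      then show ?thesis by simp
    qed
    with d(1) show ?thesis by (rule that)
  qed
  have growth: "real n * k (u / a n) \<le> 2 * (u / d)\<^sup>2 + 2" if n: "n0 \<le> n" for n u
  proof -
    define x where "x = \<bar>u\<bar> / d"
    \<comment> \<open>An integer just above \<open>\<bar>u\<bar> / d\<close>, so that
      \<open>u / m\<close> falls into the range of \<open>small\<close>; the successor keeps it
      positive.\<close>
    define m where "m = Suc (nat \<lfloor>x\<rfloor>)"
    have x: "0 \<le> x" using d by (simp add: x_def)
    have "real m = real_of_int \<lfloor>x\<rfloor> + 1" using x by (simp add: m_def)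
    then have m: "x \<le> real m" "real m \<le> x + 1"
      using real_of_int_floor_add_one_ge[of x] of_int_floor_le[of x] by linarith+
    have m0: "0 < m" by (simp add: m_def)
    have "\<bar>u / real m\<bar> \<le> d"
      using m(1) m0 d by (simp add: x_def abs_divide pos_divide_le_eq mult.commute)
    then have "real n * k (u / real m / a n) \<le> 1" by (rule small[OF n])
    moreover have "k (u / a n) \<le> (real m)\<^sup>2 * k (u / real m / a n)"
      using N.cos_gap_mult_le[of m "u / real m / a n"] m0 by (simp add: k_def)
    then have "real n * k (u / a n) \<le> real n * ((real m)\<^sup>2 * k (u / real m / a n))"
      by (rule mult_left_mono) simp
    ultimately have "real n * k (u / a n) \<le> (real m)\<^sup>2 * 1"
      using mult_left_mono[of "real n * k (u / real m / a n)" 1 "(real m)\<^sup>2"] by (simp add: algebra_simps)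
    also have "\<dots> \<le> (x + 1)\<^sup>2" using m by (simp add: power_mono)
    also have "\<dots> \<le> 2 * x\<^sup>2 + 2"
      using zero_le_power2[of "x - 1"] by (simp add: power2_eq_square algebra_simps)
    finally show ?thesis by (simp add: x_def power_divide)
  qed
  define \<Gamma> where "\<Gamma> s = (LINT u|lborel. l (s * u) * ?\<phi> u)" for s
  have [measurable]: "k \<in> borel_measurable borel" "kD \<in> borel_measurable borel"
    using N.cos_gap_measurable ND.cos_gap_measurable by (auto simp: k_def kD_def)
  have [measurable]: "l \<in> borel_measurable borel" unfolding l_def by measurable
  have dom_int: "integrable lborel (\<lambda>u. ?\<phi> u * (2 * (s * u / d)\<^sup>2 + 2))" for s
  proof -
    have "integrable lborel (\<lambda>u. (2 * (s / d)\<^sup>2) * (?\<phi> u * u ^ 2) + 2 * ?\<phi> u)"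
      by (intro Bochner_Integration.integrable_add integrable_mult_right integrable_std_normal_moment) simp
    then show ?thesis
      by (rule Bochner_Integration.integrable_cong[THEN iffD1, rotated -1])
         (auto simp: power_mult_distrib power_divide algebra_simps)
  qed
  have Glim: "(\<lambda>n. real n * ?G (s / a n)) \<longlonglongrightarrow> \<Gamma> s" and l_int: "integrable lborel (\<lambda>u. l (s * u) * ?\<phi> u)" for s
  proof -
    \<comment> \<open>The shift by \<open>n0\<close> makes the growth bound valid at every
      index.\<close>
    let ?F = "\<lambda>n u. real (n + n0) * k (s * u / a (n + n0)) * ?\<phi> u"
    let ?w = "\<lambda>u. ?\<phi> u * (2 * (s * u / d)\<^sup>2 + 2)"
    have l1: "AE u in lborel. (\<lambda>n. ?F n u) \<longlonglongrightarrow> l (s * u) * ?\<phi> u"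
      using LIMSEQ_ignore_initial_segment[OF klim] by (intro AE_I2 tendsto_intros) simp
    have l2: "AE u in lborel. norm (?F n u) \<le> ?w u" for n
    proof (rule AE_I2)
      fix u
      have "real (n + n0) * k (s * u / a (n + n0)) * ?\<phi> u \<le> (2 * (s * u / d)\<^sup>2 + 2) * ?\<phi> u"
        by (intro mult_right_mono growth) auto
      then show "norm (?F n u) \<le> ?w u" using k01 by (simp add: mult.commute)
    qed
    have "(\<lambda>n. LINT u|lborel. ?F n u) \<longlonglongrightarrow> \<Gamma> s"
      unfolding \<Gamma>_def by (rule integral_dominated_convergence[OF _ _ dom_int l1 l2]) measurable
    moreover have "(LINT u|lborel. ?F n u) = real (n + n0) * ?G (s / a (n + n0))" for n
      unfolding N.gauss_gap_eq_integral_cos_gap k_def by (simp add: mult.assoc)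
    ultimately have "(\<lambda>n. real (n + n0) * ?G (s / a (n + n0))) \<longlonglongrightarrow> \<Gamma> s" by (simp only:)
    then show "(\<lambda>n. real n * ?G (s / a n)) \<longlonglongrightarrow> \<Gamma> s"
      by (rule LIMSEQ_offset[of "\<lambda>n. real n * ?G (s / a n)"])
    show "integrable lborel (\<lambda>u. l (s * u) * ?\<phi> u)"
      by (rule integrable_dominated_convergence[OF _ _ dom_int l1 l2]) measurable
  qed
  have \<Gamma>1: "0 < \<Gamma> 1"
  proof -
    have "0 < gauss_gap (symmetrization D) 1" by (rule D.gauss_gap_symmetrization_pos[OF nondeg])
    also have "\<dots> = (LINT u|lborel. kD (1 * u) * ?\<phi> u)"
      unfolding ND.gauss_gap_eq_integral_cos_gap kD_def ..
    also have "\<dots> \<le> \<Gamma> 1"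
      unfolding \<Gamma>_def
    proof (rule integral_mono[OF _ l_int])
      show "integrable lborel (\<lambda>u. kD (1 * u) * ?\<phi> u)"
        by (rule Bochner_Integration.integrable_bound[of _ ?\<phi>])
           (use kD01 in \<open>auto simp: abs_mult mult_left_le_one_le\<close>)
      \<comment> \<open>\<open>- ln z \<ge> 1 - z\<close> at \<open>z = 1 - kD u\<close>.\<close>
      show "kD (1 * u) * ?\<phi> u \<le> l (1 * u) * ?\<phi> u" for u
        using ln_le_minus_one[OF kD_pos[of u]] by (intro mult_right_mono) (auto simp: l_def)
    qed
    finally show ?thesis .
  qed
  have \<Gamma>_mono: "\<Gamma> s \<le> \<Gamma> t" if "0 < s" "s \<le> t" for s t
    using Glim[of s] Glim[of t]
    by (rule LIMSEQ_le)
       (use that a in \<open>auto intro!: exI[of _ 0] mult_left_mono N.gauss_gap_mono divide_right_mono simp: less_imp_le\<close>)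
  have l_hom: "l (real n powr (1 / \<alpha>) * t) = real n * l t" if "1 \<le> n" for n t
  proof -
    have "1 - kD (real n powr (1 / \<alpha>) * t) = (1 - kD t) ^ n"
      by (simp add: kD_def D.cos_gap_symmetrization stable_law_char_power[OF D that] flip: power_mult) (simp add: mult.commute)
    then show ?thesis using kD_pos[of t] by (simp add: l_def ln_realpow)
  qed
  have \<Gamma>_powr: "\<Gamma> s = \<Gamma> 1 * s powr \<alpha>" if s: "0 < s" for s
  proof -
    \<comment> \<open>The substitution turns the scaling of \<open>l\<close> under
      \<open>n powr (1 / \<alpha>)\<close> into homogeneity of degree 1.\<close>
    define V where "V x = \<Gamma> (x powr (1 / \<alpha>))" for x
    have "V (s powr \<alpha>) = s powr \<alpha> * V 1"
    proof (rule monotone_homogeneous_imp_linear)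
      show "V x \<le> V y" if "0 < x" "x \<le> y" for x y
        unfolding V_def using that \<alpha> by (intro \<Gamma>_mono powr_mono2) auto
      show "V (real n * x) = real n * V x" if "1 \<le> n" "0 < x" for n x
        using that unfolding V_def \<Gamma>_def by (simp add: powr_mult mult.assoc l_hom)
    qed (use s in simp)
    then show ?thesis using s \<alpha> by (simp add: V_def powr_powr mult.commute)
  qed
  \<comment> \<open>Convergence of \<open>n * ?G (1 / a n)\<close> forces
    \<open>?G (1 / a n)\<close> to 0. As \<open>?G r > 0\<close> for each \<open>r > 0\<close> (else
    \<open>?G\<close> and thus \<open>\<Gamma> 1\<close> would vanish), monotonicity pushes
    \<open>1 / a n\<close> below \<open>r\<close>.\<close>
  have a_lim: "filterlim a at_top sequentially"
    unfolding filterlim_at_top_dense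
  proof
    fix Z :: real
    define r where "r = 1 / max Z 1"
    have r: "0 < r" by (simp add: r_def)
    have "?G r \<noteq> 0"
    proof
      assume "?G r = 0"
      then have "AE y in symmetrization M. y = 0" by (rule N.gauss_gap_eq_0_imp_AE) (use r in simp)
      then have "?G s = 0" for s
        unfolding gauss_gap_def by (intro integral_eq_zero_AE) (auto elim: eventually_mono)
      then have "(\<lambda>n. 0) \<longlonglongrightarrow> \<Gamma> 1" using Glim[of 1] by simp
      then show False using \<Gamma>1 by (simp add: LIMSEQ_const_iff)
    qed
    then have pos: "0 < ?G r" using N.gauss_gap_nonneg[of r] by linarith
    have "(\<lambda>n. (real n * ?G (1 / a n)) * (1 / real n)) \<longlonglongrightarrow> \<Gamma> 1 * 0"
      by (intro tendsto_mult Glim lim_1_over_n)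
    then have "eventually (\<lambda>n. (real n * ?G (1 / a n)) * (1 / real n) < ?G r) sequentially"
      by (rule order_tendstoD) (use pos in simp)
    with eventually_gt_at_top[of 0] show "eventually (\<lambda>n. Z < a n) sequentially"
    proof eventually_elim
      case (elim n)
      have "?G (1 / a n) < ?G r" using elim by simp
      then have "1 / a n < r" using N.gauss_gap_mono[of r "1 / a n"] r by (meson not_less less_imp_le)
      then have "max Z 1 < a n" using a[of n] by (simp add: r_def field_simps)
      then show ?case by simp
    qed
  qed
  show ?thesis
  proof (rule regvar_0_from_sequence[OF _ a a_lim _ \<Gamma>1])
    show "(\<lambda>n. real n * ?G (s / a n)) \<longlonglongrightarrow> \<Gamma> 1 * s powr \<alpha>" if "0 < s" for s
      using Glim[of s] unfolding \<Gamma>_powr[OF that] .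
  qed (auto intro: N.gauss_gap_mono)
qed

subsection \<open>The logarithmic derivative\<close>

text \<open>The quotient is rewritten as \<open>q\<close>, which lies in [0, 1], so every limit
  does. Each existence claim reduces to regular variation of \<open>laplace_gap\<close> with the
  stated index, index 1 for finite mean.\<close>

theorem lemma2p17:
  fixes \<mu> :: "real measure" and g :: "real \<Rightarrow> real"
  assumes "real_distribution \<mu>"
    and "measure \<mu> {1..} = 1"
  defines "g \<equiv> laplace_transform \<mu>"
  shows "(\<forall>c\<^sub>0. ((\<lambda>s. - (s * deriv g s / (1 - g s))) \<longlongrightarrow> c\<^sub>0) (at_right 0)
            \<longrightarrow> 0 \<le> c\<^sub>0 \<and> c\<^sub>0 \<le> 1)
    \<and> (integrable \<mu> (\<lambda>x. x)
            \<longrightarrow> ((\<lambda>s. - (s * deriv g s / (1 - g s))) \<longlongrightarrow> 1) (at_right 0))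
    \<and> (\<forall>\<alpha>. (0 < \<alpha> \<and> \<alpha> < 1 \<and> (\<exists>D. stable_law \<alpha> D \<and> in_domain_of_attraction \<mu> D))
          \<or> (0 \<le> \<alpha> \<and> \<alpha> \<le> 1 \<and>
              (\<exists>L. slowly_varying L \<and> (\<forall>x\<ge>1. measure \<mu> {x<..} = x powr (- \<alpha>) * L x)))
            \<longrightarrow> ((\<lambda>s. - (s * deriv g s / (1 - g s))) \<longlongrightarrow> \<alpha>) (at_right 0))"
proof -
  interpret real_distribution \<mu> by fact
  have "AE x in \<mu>. x \<in> {1..}" using assms(2) by (subst prob_eq_1[symmetric]) auto
  then interpret distribution_ge_1 \<mu> by unfold_locales simp
  define q where "q = (\<lambda>s. s * laplace_gap_deriv \<mu> s / laplace_gap \<mu> s)"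
  have eq: "eventually (\<lambda>s. q s = - (s * deriv g s / (1 - g s))) (at_right 0)"
    using eventually_at_right_less[of 0]
    by eventually_elim (simp add: q_def g_def laplace_log_derivative_eq)
  have lim_iff: "((\<lambda>s. - (s * deriv g s / (1 - g s))) \<longlongrightarrow> c) (at_right 0) \<longleftrightarrow> (q \<longlongrightarrow> c) (at_right 0)" for c
    by (rule tendsto_cong[symmetric]) (rule eq)
  have lim: "(q \<longlongrightarrow> \<alpha>) (at_right 0)" if "regvar_0 \<alpha> (laplace_gap \<mu>)" for \<alpha>
    unfolding q_def
    using that laplace_gap_pos laplace_gap_tangent by (rule regvar_0_imp_log_derivative_limit)
  have bounds: "0 \<le> c \<and> c \<le> 1" if "(q \<longlongrightarrow> c) (at_right 0)" for c
  proof
    have ev: "eventually (\<lambda>s. 0 \<le> q s \<and> q s \<le> 1) (at_right 0)"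
      using eventually_at_right_less[of 0]
      by eventually_elim (simp add: q_def laplace_log_derivative_bounds)
    show "0 \<le> c" by (rule tendsto_lowerbound[OF that]) (use ev in \<open>auto elim: eventually_mono\<close>)
    show "c \<le> 1" by (rule tendsto_upperbound[OF that]) (use ev in \<open>auto elim: eventually_mono\<close>)
  qed
  have attraction: "regvar_0 \<alpha> (laplace_gap \<mu>)"
    if "\<alpha> < 1" "stable_law \<alpha> D" "in_domain_of_attraction \<mu> D" for \<alpha> D
    using regvar_0_gauss_gap_domain_of_attraction[OF assms(1) that(2,3)] that(1)
    by (rule regvar_0_laplace_gap_symmetrization)
  show ?thesis
    unfolding lim_iff
    using bounds lim regvar_0_laplace_gap_finite_mean attraction regvar_0_laplace_gap_tail by blast
qed

end
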